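(* Assume the Generalized Continuum Hypothesis (GCH). Let $A$ be a torsion-free abelian group of uncountable cardinality. If $\operatorname{Hom}(A,\mathbb{Z})=0$ and $\nu_0(A)<2^{|A|}$, then $\nu_p(A)=2^{|A|}$ for every prime $p$.
   Context: For a torsion-free abelian group $A$, the group $\operatorname{Ext}(A,\mathbb{Z})$ is divisible, hence isomorphic to $\mathbb{Q}^{(\nu_0(A))}\oplus\bigoplus_{p}\mathbb{Z}(p^\infty)^{(\nu_p(A))}$ ($p$ ranging over the primes) for uniquely determined cardinals $\nu_0(A)$ (the torsion-free rank of $\operatorname{Ext}(A,\mathbb{Z})$) and $\nu_p(A)$ (the $p$-rank of $\operatorname{Ext}(A,\mathbb{Z})$). All groups are abelian. *)

theory Defs
  imports
    "HOL-Algebra.Free_Abelian_Groups"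
    "HOL-Algebra.Multiplicative_Group"
    "HOL-Computational_Algebra.Primes"
begin

unbundle cardinal_syntax

text \<open>
  HOL cannot quantify over types inside a formula, so the Generalized Continuum Hypothesis is
  relative to a universe \<open>'u\<close>: \<open>2\<^sup>\<kappa> = \<kappa>\<^sup>+\<close> for all infinite cardinals \<open>\<kappa> \<le> |'u|\<close>. It is a consequence of
  the unrestricted GCH.
\<close>

definition GCH :: "'u itself \<Rightarrow> bool" where
  "GCH _ \<longleftrightarrow> (\<forall>X :: 'u set. infinite X \<longrightarrow> ctwo ^c |X| =o cardSuc |X| )"

definition torsion_free :: "('a, 'm) monoid_scheme \<Rightarrow> bool" where
  "torsion_free G \<longleftrightarrow>
     (\<forall>x \<in> carrier G. \<forall>n :: nat. n > 0 \<longrightarrow> x [^]\<^bsub>G\<^esub> n = \<one>\<^bsub>G\<^esub> \<longrightarrow> x = \<one>\<^bsub>G\<^esub>)"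

text \<open>
  \<open>hom G H\<close> leaves the values outside \<open>carrier G\<close> unspecified; extensionality makes homomorphisms
  that agree on \<open>carrier G\<close> equal.
\<close>

definition hom_group ::
    "('a, 'm) monoid_scheme \<Rightarrow> ('b, 'n) monoid_scheme \<Rightarrow> ('a \<Rightarrow> 'b) monoid" where
  "hom_group G H =
     \<lparr>carrier = hom G H \<inter> extensional (carrier G),
      monoid.mult = (\<lambda>f g. \<lambda>x\<in>carrier G. f x \<otimes>\<^bsub>H\<^esub> g x),
      one = (\<lambda>x\<in>carrier G. \<one>\<^bsub>H\<^esub>)\<rparr>"

text \<open>
  \<open>Ext A G\<close> is computed from the standard free resolution
  \<open>0 \<rightarrow> R \<rightarrow> F \<rightarrow> A \<rightarrow> 0\<close>, where \<open>F\<close> is the free abelian group on the set \<open>carrier A\<close>, as the cokernel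
  of the restriction map \<open>Hom(F, G) \<rightarrow> Hom(R, G)\<close>. The groups of the library being written
  multiplicatively, the formal sum \<open>\<Sum> n\<^sub>a a\<close> is sent to the product of the powers of \<open>a\<close>
  with exponents \<open>n\<^sub>a\<close>.
\<close>

definition free_eval :: "('a, 'm) monoid_scheme \<Rightarrow> ('a \<Rightarrow>\<^sub>0 int) \<Rightarrow> 'a" where
  "free_eval A c = finprod A (\<lambda>a. a [^]\<^bsub>A\<^esub> Poly_Mapping.lookup c a) (Poly_Mapping.keys c)"

definition relation_group :: "('a, 'm) monoid_scheme \<Rightarrow> ('a \<Rightarrow>\<^sub>0 int) monoid" where
  "relation_group A =
     (free_Abelian_group (carrier A))
       \<lparr>carrier := kernel (free_Abelian_group (carrier A)) A (free_eval A)\<rparr>"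

definition Ext ::
    "('a, 'm) monoid_scheme \<Rightarrow> ('b, 'n) monoid_scheme \<Rightarrow> (('a \<Rightarrow>\<^sub>0 int) \<Rightarrow> 'b) set monoid" where
  "Ext A G =
     hom_group (relation_group A) G Mod
       ((\<lambda>f. restrict f (carrier (relation_group A))) `
          carrier (hom_group (free_Abelian_group (carrier A)) G))"

definition independent :: "('a, 'm) monoid_scheme \<Rightarrow> 'a set \<Rightarrow> bool" where
  "independent G S \<longleftrightarrow>
     S \<subseteq> carrier G - {\<one>\<^bsub>G\<^esub>} \<and>
     (\<forall>T n. finite T \<longrightarrow> T \<subseteq> S \<longrightarrow> finprod G (\<lambda>x. x [^]\<^bsub>G\<^esub> (n x :: int)) T = \<one>\<^bsub>G\<^esub> \<longrightarrow>
        (\<forall>x \<in> T. x [^]\<^bsub>G\<^esub> n x = \<one>\<^bsub>G\<^esub>))"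

definition maximal_independent :: "('a, 'm) monoid_scheme \<Rightarrow> 'a set \<Rightarrow> 'a set \<Rightarrow> bool" where
  "maximal_independent G X S \<longleftrightarrow>
     independent G S \<and> S \<subseteq> X \<and> (\<forall>T. independent G T \<and> T \<subseteq> X \<and> S \<subseteq> T \<longrightarrow> T = S)"

text \<open>
  The torsion-free rank and the \<open>p\<close>-rank of an abelian group are the cardinalities of its maximal
  independent systems of elements of infinite order, respectively of elements of \<open>p\<close>-power order;
  these do not depend on the chosen system. In the library, \<open>group.ord G x = 0\<close> says that \<open>x\<close> has
  infinite order.
\<close>

definition torsion_free_rank :: "('a, 'm) monoid_scheme \<Rightarrow> 'a rel" where
  "torsion_free_rank G =
     |SOME S. maximal_independent G {x \<in> carrier G. group.ord G x = 0} S|"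

definition p_rank :: "nat \<Rightarrow> ('a, 'm) monoid_scheme \<Rightarrow> 'a rel" where
  "p_rank p G =
     |SOME S. maximal_independent G {x \<in> carrier G. \<exists>k. group.ord G x = p ^ k} S|"

definition nu_0 :: "('a, 'm) monoid_scheme \<Rightarrow> (('a \<Rightarrow>\<^sub>0 int) \<Rightarrow> int) set rel" where
  "nu_0 A = torsion_free_rank (Ext A integer_group)"

definition nu :: "nat \<Rightarrow> ('a, 'm) monoid_scheme \<Rightarrow> (('a \<Rightarrow>\<^sub>0 int) \<Rightarrow> int) set rel" where
  "nu p A = p_rank p (Ext A integer_group)"

end

theory Submission
  imports Defs
begin

text \<open>
  An element of \<open>Ext A \<int>\<close> is represented by a map \<open>u : A \<rightarrow> \<rat>\<close> that is additive modulo \<open>\<int>\<close>; the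
  class of \<open>u\<close> is trivial iff \<open>u\<close> differs from a homomorphism \<open>A \<rightarrow> \<rat>\<close> by an integral function.
  Let \<open>\<kappa> = |A|\<close> and let \<open>p\<close> be prime. If \<open>A/pA\<close> has dimension \<open>\<kappa>\<close>, the maps \<open>A \<rightarrow> \<int>/p\<close> give
  \<open>2\<^sup>\<kappa>\<close> classes of order \<open>p\<close>, which are distinct because \<open>Hom(A, \<int>) = 0\<close>. Otherwise \<open>A = B + pA\<close>
  for a subgroup \<open>B\<close> of cardinality less than \<open>\<kappa>\<close>. There are \<open>2\<^sup>\<kappa>\<close> homomorphisms \<open>A/B \<rightarrow> \<rat>\<close>, and
  composing them with multiplication by an irrational \<open>p\<close>-adic integer, viewed as a map
  \<open>\<rat> \<rightarrow> \<rat>/\<int>\<close>, gives classes of which only \<open>2\<^bsup>|B|\<^esup>\<close> are identified modulo torsion. By GCH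
  \<open>2\<^bsup>|B|\<^esup> \<le> \<kappa>\<close>, so \<open>\<nu>\<^sub>0(A) = 2\<^sup>\<kappa>\<close>, contrary to the hypothesis.
\<close>

subsection \<open>Maximal independent systems\<close>

context comm_group
begin

lemma independentD:
  assumes "independent G S" "finite T" "T \<subseteq> S"
    and "finprod G (\<lambda>x. x [^] (n x :: int)) T = \<one>" "x \<in> T"
  shows "x [^] n x = \<one>"
  using assms unfolding independent_def by metis

text \<open>Guarantees that the systems picked by \<open>SOME\<close> in the definitions of the
  ranks exist. Independence is a condition on finite subsets, and a finite subset of the union of a
  chain lies in one member, so Zorn's lemma applies.\<close>

lemma ex_maximal_independent: "\<exists>S. maximal_independent G X S"
proof -
  let ?F = "{S. independent G S \<and> S \<subseteq> X}"
  have "\<exists>S\<in>?F. \<forall>T\<in>?F. S \<subseteq> T \<longrightarrow> T = S"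
  proof (rule subset_Zorn_nonempty)
    show "?F \<noteq> {}"
      by (auto simp: independent_def intro!: exI [of _ "{}"])
    fix C assume ne: "C \<noteq> {}" and C: "subset.chain ?F C"
    have CF: "C \<subseteq> ?F"
      using C by (auto simp: subset.chain_def)
    have "\<forall>x\<in>T. x [^] n x = \<one>"
      if T: "finite T" "T \<subseteq> \<Union>C" "finprod G (\<lambda>x. x [^] (n x :: int)) T = \<one>" for T n
    proof -
      obtain S where "S \<in> C" "T \<subseteq> S"
        using finite_subset_Union_chain [OF T(1,2) ne C] by blast
      then show ?thesis
        using CF independentD [of S T n] T(1,3) by auto
    qed
    moreover have "\<Union>C \<subseteq> carrier G - {\<one>}" "\<Union>C \<subseteq> X"
      using CF by (auto simp: independent_def)
    ultimately show "\<Union>C \<in> ?F"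
      by (simp add: independent_def)
  qed
  then obtain S where "independent G S" "S \<subseteq> X"
    and "\<And>T. independent G T \<Longrightarrow> T \<subseteq> X \<Longrightarrow> S \<subseteq> T \<Longrightarrow> T = S"
    by auto
  then show ?thesis
    unfolding maximal_independent_def by (intro exI [of _ S]) simp
qed

lemma finprod_pow_in_generate:
  assumes "S \<subseteq> carrier G" "finite T" "T \<subseteq> S"
  shows "finprod G (\<lambda>x. x [^] (n x :: int)) T \<in> generate G S"
  using assms(2,3)
proof (induction T rule: finite_induct)
  case (insert x T)
  interpret S: subgroup "generate G S" G
    using assms(1) by (rule generate_is_subgroup)
  have "x [^] n x \<in> generate G S"
    using insert.prems assms(1) generate.incl [of x S G] S.subgroup_axioms subgroup_int_pow_closed by blast
  with insert assms(1) show ?case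
    by (subst finprod_insert) (auto intro!: int_pow_closed)
qed (simp add: generate.one)

text \<open>For \<open>x\<close> outside \<open>S\<close>, maximality gives a nontrivial finite
  relation on \<open>insert x S\<close>. It must involve \<open>x\<close>, and solving it for the
  power of \<open>x\<close> puts that power into the subgroup generated by \<open>S\<close>.\<close>

lemma maximal_independent_int_pow:
  assumes S: "maximal_independent G X S" and x: "x \<in> X" "x \<in> carrier G" "x \<noteq> \<one>"
  shows "\<exists>n :: int. x [^] n \<noteq> \<one> \<and> x [^] n \<in> generate G S"
proof (cases "x \<in> S")
  case True
  then show ?thesis
    using x by (intro exI [of _ 1]) (auto intro: generate.incl)
next
  case False
  have indS: "independent G S" and SX: "S \<subseteq> X" and Sc: "S \<subseteq> carrier G"
    using S by (auto simp: maximal_independent_def independent_def)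
  have "\<not> independent G (insert x S)"
    using S False x(1) unfolding maximal_independent_def by blast
  then obtain T n y where T: "finite T" "T \<subseteq> insert x S"
    and eq: "finprod G (\<lambda>x. x [^] (n x :: int)) T = \<one>" and y: "y \<in> T" "y [^] n y \<noteq> \<one>"
    using indS x unfolding independent_def by blast
  define T' where "T' = T - {x}"
  have T': "finite T'" "T' \<subseteq> S" "x \<notin> T'" "T' \<subseteq> carrier G"
    using T Sc by (auto simp: T'_def)
  let ?P = "finprod G (\<lambda>x. x [^] n x) T'"
  have PS: "?P \<in> generate G S"
    using Sc T' by (intro finprod_pow_in_generate) auto
  have Pc: "?P \<in> carrier G"
    using T' by (intro finprod_closed) (auto intro: int_pow_closed)
  \<comment> \<open>If the nontrivial factor is not that of \<open>x\<close>, it lies in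
    \<open>T'\<close>, and independence of \<open>S\<close> keeps \<open>?P\<close> from being
    trivial. In both cases the power of \<open>x\<close> is nontrivial.\<close>
  have noP: "?P \<noteq> \<one> \<or> (y = x)"
    using independentD [OF indS T'(1,2), of n y] y by (auto simp: T'_def)
  have "x \<in> T"
    using independentD [OF indS T(1) _ eq y(1)] y(2) T(2) by auto
  then have "T = insert x T'"
    by (auto simp: T'_def)
  then have "x [^] n x \<otimes> ?P = \<one>"
    using eq T' x(2) by (simp add: Pi_iff subset_iff)
  then have inv: "x [^] n x = inv ?P"
    using Pc x(2) by (intro inv_equality [symmetric]) auto
  have "x [^] n x \<noteq> \<one>"
    using inv noP Pc y by (auto simp: inv_eq_1_iff)
  moreover have "x [^] n x \<in> generate G S"
    using inv PS Sc generate_m_inv_closed by simp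
  ultimately show ?thesis by blast
qed

text \<open>Every element generated is the product of a finite list over \<open>S\<close> and its
  inverses, and finite lists do not exceed an infinite cardinal bounding their alphabet.\<close>

lemma card_of_generate_le:
  assumes "S \<subseteq> carrier G" "infinite Z" "|S| \<le>o |Z|"
  shows "|generate G S| \<le>o |Z|"
proof -
  let ?D = "S \<union> m_inv G ` S"
  have D: "|?D| \<le>o |Z|"
    using assms(2,3) card_of_image [of "m_inv G" S] card_of_Un_ordLeq_infinite ordLeq_transitive by blast
  have prod: "foldr (\<otimes>) xs \<one> \<in> carrier G" if "set xs \<subseteq> ?D" for xs
    using that assms(1) by (induction xs) auto
  have app: "foldr (\<otimes>) (xs @ ys) \<one> = foldr (\<otimes>) xs \<one> \<otimes> foldr (\<otimes>) ys \<one>"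
    if "set xs \<subseteq> ?D" "set ys \<subseteq> ?D" for xs ys
    using that(1)
  proof (induction xs)
    case Nil
    then show ?case using prod [OF that(2)] by simp
  next
    case (Cons a xs)
    then have "a \<in> carrier G" "set xs \<subseteq> ?D" using assms(1) by auto
    then show ?case using Cons.IH prod that(2) by (simp add: m_assoc)
  qed
  have "x \<in> (\<lambda>xs. foldr (\<otimes>) xs \<one>) ` lists ?D" if "x \<in> generate G S" for x
    using that
  proof (induction rule: generate.induct)
    case one
    show ?case by (rule image_eqI [of _ _ "[]"]) auto
  next
    case (incl h)
    then show ?case using assms(1) by (intro image_eqI [of _ _ "[h]"]) auto
  next
    case (inv h)
    then show ?case using assms(1) by (intro image_eqI [of _ _ "[inv h]"]) auto
  next
    case (eng h1 h2)
    then obtain xs ys where *: "h1 = foldr (\<otimes>) xs \<one>" "h2 = foldr (\<otimes>) ys \<one>"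
      "set xs \<subseteq> ?D" "set ys \<subseteq> ?D" by (auto simp: lists_eq_set)
    then show ?case using app [of xs ys] by (intro image_eqI [of _ _ "xs @ ys"]) auto
  qed
  then have "|generate G S| \<le>o |(\<lambda>xs. foldr (\<otimes>) xs \<one>) ` lists ?D|"
    by (intro card_of_mono1) auto
  also have "|(\<lambda>xs. foldr (\<otimes>) xs \<one>) ` lists ?D| \<le>o |lists ?D|"
    by (rule card_of_image)
  also have "|lists ?D| \<le>o |lists Z|"
    using D by (rule card_of_lists_mono)
  also have "|lists Z| =o |Z|"
    using assms(2) by (rule card_of_lists_infinite)
  finally show ?thesis .
qed

end

text \<open>Converts a count of elements into a bound on a rank: generating a subgroup preserves the
  size of an infinite set, and a set of size at most |Z| generates fewer than 2^|Z|
  elements.\<close>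

lemma card_of_le_Pow_generate:
  assumes G: "comm_group G" and "S \<subseteq> carrier G" and "infinite Z" and le: "|Pow Z| \<le>o |generate G S|"
  shows "|Pow Z| \<le>o |S|"
proof (rule ccontr)
  assume "\<not> ?thesis"
  then have less: "|S| <o |Pow Z|"
    by simp
  have "|generate G S| <o |Pow Z|"
  proof (cases "|S| \<le>o |Z|")
    case True
    then show ?thesis
      using comm_group.card_of_generate_le [OF G] assms card_of_Pow ordLeq_ordLess_trans by blast
  next
    case False
    then have "|Z| \<le>o |S|" by (meson card_of_Well_order ordLeq_total)
    then have "infinite S" using \<open>infinite Z\<close> card_of_ordLeq_infinite by blast
    then show ?thesis
      using comm_group.card_of_generate_le [OF G \<open>S \<subseteq> carrier G\<close>, of S] less ordLeq_ordLess_trans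
        card_of_mono1 by blast
  qed
  then show False using le not_ordLess_ordLeq by blast
qed

subsection \<open>Classes in \<open>Ext\<close> represented by rational functions\<close>

text \<open>The target is a general ring because both rational functions and their integral
  corrections get extended.\<close>

definition lin :: "('a \<Rightarrow> 'b::comm_ring_1) \<Rightarrow> ('a \<Rightarrow>\<^sub>0 int) \<Rightarrow> 'b" where
  "lin u c = (\<Sum>a\<in>Poly_Mapping.keys c. of_int (Poly_Mapping.lookup c a) * u a)"

lemma lin_eq_sum:
  assumes "finite T" "Poly_Mapping.keys c \<subseteq> T"
  shows "lin u c = (\<Sum>a\<in>T. of_int (Poly_Mapping.lookup c a) * u a)"
  unfolding lin_def using assms by (intro sum.mono_neutral_left) (auto simp: in_keys_iff)

lemma lin_0 [simp]: "lin u 0 = 0"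
  by (simp add: lin_def)

lemma lin_frag_of [simp]: "lin u (frag_of a) = u a"
  by (simp add: lin_def)

lemma lin_add: "lin u (c + d) = lin u c + lin u d"
proof -
  let ?T = "Poly_Mapping.keys c \<union> Poly_Mapping.keys d"
  have "lin u (c + d) = (\<Sum>a\<in>?T. of_int (Poly_Mapping.lookup (c + d) a) * u a)"
    using keys_add [of c d] by (intro lin_eq_sum) auto
  also have "\<dots> = (\<Sum>a\<in>?T. of_int (Poly_Mapping.lookup c a) * u a) + (\<Sum>a\<in>?T. of_int (Poly_Mapping.lookup d a) * u a)"
    by (simp add: lookup_add algebra_simps sum.distrib)
  also have "\<dots> = lin u c + lin u d"
    by (subst (1 2) lin_eq_sum [where T = ?T]) auto
  finally show ?thesis .
qed

lemma lin_cmul: "lin u (frag_cmul n c) = of_int n * lin u c"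
  by (subst lin_eq_sum [of "Poly_Mapping.keys c"]) (auto simp: lin_def sum_distrib_left mult.assoc)

lemma lin_minus: "lin u (- c) = - lin u c"
  using lin_cmul [of u "-1" c] by simp

lemma lin_diff: "lin u (c - d) = lin u c - lin u d"
  using lin_add [of u c "- d"] by (simp add: lin_minus)

lemma lin_fun_diff: "lin (\<lambda>a. u a - v a) c = lin u c - lin v c"
  by (simp add: lin_def algebra_simps sum_subtractf)

lemma lin_fun_mult: "lin (\<lambda>a. k * u a) c = k * lin u c"
  by (simp add: lin_def sum_distrib_left algebra_simps)

lemma lin_of_int: "lin (\<lambda>a. of_int (w a)) c = of_int (lin w c)"
  by (simp add: lin_def)

lemma dvd_lin: "(\<And>a. q dvd Poly_Mapping.lookup c a) \<Longrightarrow> q dvd lin w c" for q :: int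
  by (auto simp: lin_def intro!: dvd_sum)

lemma keys_add_subset:
  "Poly_Mapping.keys c \<subseteq> S \<Longrightarrow> Poly_Mapping.keys d \<subseteq> S \<Longrightarrow> Poly_Mapping.keys (c + d) \<subseteq> S"
  using keys_add [of c d] by auto

lemma keys_diff_subset:
  "Poly_Mapping.keys c \<subseteq> S \<Longrightarrow> Poly_Mapping.keys d \<subseteq> S \<Longrightarrow> Poly_Mapping.keys (c - d) \<subseteq> S"
  using keys_diff [of c d] by auto

definition additive :: "('a, 'm) monoid_scheme \<Rightarrow> ('a \<Rightarrow> rat) \<Rightarrow> bool" where
  "additive G u \<longleftrightarrow> (\<forall>a\<in>carrier G. \<forall>b\<in>carrier G. u (a \<otimes>\<^bsub>G\<^esub> b) = u a + u b)"

lemma additive_diff: "additive G f \<Longrightarrow> additive G g \<Longrightarrow> additive G (\<lambda>a. f a - g a)"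
  by (simp add: additive_def)

text \<open>These are lifts of homomorphisms into the rationals modulo the integers.
  \<open>ext_class\<close> below carries them to \<open>Ext\<close> by the connecting map, up to
  sign.\<close>

definition additive_mod_Ints :: "('a, 'm) monoid_scheme \<Rightarrow> ('a \<Rightarrow> rat) \<Rightarrow> bool" where
  "additive_mod_Ints G u \<longleftrightarrow> (\<forall>a\<in>carrier G. \<forall>b\<in>carrier G. u (a \<otimes>\<^bsub>G\<^esub> b) - (u a + u b) \<in> \<int>)"

section \<open>The groups Hom and Ext\<close>

lemma comm_group_hom_group:
  assumes "group G" "comm_group H"
  shows "comm_group (hom_group G H)"
proof -
  interpret G: group G by fact
  interpret H: comm_group H by fact
  have cl: "f x \<in> carrier H" if "f \<in> hom G H" "x \<in> carrier G" for f x
    using that by (auto simp: hom_def)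
  show ?thesis
  proof (rule comm_groupI)
    fix f g assume "f \<in> carrier (hom_group G H)" "g \<in> carrier (hom_group G H)"
    then have "f \<in> hom G H" "g \<in> hom G H"
      by (auto simp: hom_group_def)
    then have "(\<lambda>x. f x \<otimes>\<^bsub>H\<^esub> g x) \<in> hom G H"
      by (rule H.hom_group_mult)
    then show "f \<otimes>\<^bsub>hom_group G H\<^esub> g \<in> carrier (hom_group G H)"
      by (simp add: hom_group_def hom_def Pi_iff)
  next
    show "\<one>\<^bsub>hom_group G H\<^esub> \<in> carrier (hom_group G H)"
      by (auto simp: hom_group_def hom_def)
  next
    fix f g h assume "f \<in> carrier (hom_group G H)" "g \<in> carrier (hom_group G H)" "h \<in> carrier (hom_group G H)"
    then show "f \<otimes>\<^bsub>hom_group G H\<^esub> g \<otimes>\<^bsub>hom_group G H\<^esub> h = f \<otimes>\<^bsub>hom_group G H\<^esub> (g \<otimes>\<^bsub>hom_group G H\<^esub> h)"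
      using cl by (auto simp: hom_group_def H.m_assoc intro!: restrict_ext)
  next
    fix f g assume "f \<in> carrier (hom_group G H)" "g \<in> carrier (hom_group G H)"
    then show "f \<otimes>\<^bsub>hom_group G H\<^esub> g = g \<otimes>\<^bsub>hom_group G H\<^esub> f"
      using cl by (auto simp: hom_group_def H.m_comm intro!: restrict_ext)
  next
    fix f assume f: "f \<in> carrier (hom_group G H)"
    then show "\<one>\<^bsub>hom_group G H\<^esub> \<otimes>\<^bsub>hom_group G H\<^esub> f = f"
      using cl by (auto simp: hom_group_def intro!: extensionalityI [of _ "carrier G"])
    have fh: "f \<in> hom G H"
      using f by (simp add: hom_group_def)
    have "inv\<^bsub>H\<^esub> f (x \<otimes>\<^bsub>G\<^esub> y) = inv\<^bsub>H\<^esub> f x \<otimes>\<^bsub>H\<^esub> inv\<^bsub>H\<^esub> f y" if "x \<in> carrier G" "y \<in> carrier G" for x y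
      using cl [OF fh that(1)] cl [OF fh that(2)] by (simp add: hom_mult [OF fh that] H.inv_mult)
    then have "(\<lambda>x\<in>carrier G. inv\<^bsub>H\<^esub> f x) \<in> carrier (hom_group G H)"
      using cl [OF fh] by (simp add: hom_group_def hom_def Pi_iff)
    moreover have "(\<lambda>x\<in>carrier G. inv\<^bsub>H\<^esub> f x) \<otimes>\<^bsub>hom_group G H\<^esub> f = \<one>\<^bsub>hom_group G H\<^esub>"
      using cl [OF fh] by (auto simp: hom_group_def intro!: restrict_ext)
    ultimately show "\<exists>g\<in>carrier (hom_group G H). g \<otimes>\<^bsub>hom_group G H\<^esub> f = \<one>\<^bsub>hom_group G H\<^esub>"
      by blast
  qed
qed

context comm_group
begin

lemma free_eval_eq_finprod:
  assumes "finite T" "Poly_Mapping.keys c \<subseteq> T" "T \<subseteq> carrier G"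
  shows "free_eval G c = finprod G (\<lambda>a. a [^] Poly_Mapping.lookup c a) T"
  unfolding free_eval_def using assms
  by (intro finprod_mono_neutral_cong_left) (auto simp: in_keys_iff)

lemma free_eval_0 [simp]: "free_eval G 0 = \<one>"
  by (simp add: free_eval_def)

lemma free_eval_frag_of [simp]: "a \<in> carrier G \<Longrightarrow> free_eval G (frag_of a) = a"
  by (subst free_eval_eq_finprod [of "{a}"]) auto

lemma free_eval_closed [simp]: "Poly_Mapping.keys c \<subseteq> carrier G \<Longrightarrow> free_eval G c \<in> carrier G"
  unfolding free_eval_def by (intro finprod_closed) auto

lemma free_eval_add:
  assumes "Poly_Mapping.keys c \<subseteq> carrier G" "Poly_Mapping.keys d \<subseteq> carrier G"
  shows "free_eval G (c + d) = free_eval G c \<otimes> free_eval G d"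
proof -
  let ?T = "Poly_Mapping.keys c \<union> Poly_Mapping.keys d"
  have T: "?T \<subseteq> carrier G" using assms by auto
  have "free_eval G (c + d) = finprod G (\<lambda>a. a [^] Poly_Mapping.lookup (c + d) a) ?T"
    using keys_add [of c d] T by (intro free_eval_eq_finprod) auto
  also have "\<dots> = finprod G (\<lambda>a. a [^] Poly_Mapping.lookup c a \<otimes> a [^] Poly_Mapping.lookup d a) ?T"
    using T by (intro finprod_cong) (auto simp: lookup_add int_pow_mult simp_implies_def)
  also have "\<dots> = free_eval G c \<otimes> free_eval G d"
    using T by (subst (1 2) free_eval_eq_finprod [where T = ?T]) (auto intro!: finprod_multf)
  finally show ?thesis .
qed

lemma free_eval_hom: "free_eval G \<in> hom (free_Abelian_group (carrier G)) G"
  by (auto simp: hom_def free_eval_add)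

lemma free_eval_cmul:
  "Poly_Mapping.keys c \<subseteq> carrier G \<Longrightarrow> free_eval G (frag_cmul n c) = free_eval G c [^] n"
  using hom_int_pow [OF free_eval_hom, of c n] by (simp add: is_group)

lemma free_eval_minus:
  "Poly_Mapping.keys c \<subseteq> carrier G \<Longrightarrow> free_eval G (- c) = inv (free_eval G c)"
  using free_eval_cmul [of c "-1"] by (simp add: int_pow_neg)

lemma free_eval_diff:
  assumes "Poly_Mapping.keys c \<subseteq> carrier G" "Poly_Mapping.keys d \<subseteq> carrier G"
  shows "free_eval G (c - d) = free_eval G c \<otimes> inv (free_eval G d)"
  using free_eval_add [of c "- d"] assms by (simp add: free_eval_minus)

lemma carrier_relation_group:
  "carrier (relation_group G) = {c. Poly_Mapping.keys c \<subseteq> carrier G \<and> free_eval G c = \<one>}"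
  by (auto simp: relation_group_def kernel_def)

lemma mult_relation_group [simp]: "c \<otimes>\<^bsub>relation_group G\<^esub> d = c + d"
  by (simp add: relation_group_def)

lemma group_relation_group: "group (relation_group G)"
proof -
  interpret h: group_hom "free_Abelian_group (carrier G)" G "free_eval G"
    by (simp add: group_hom_def group_hom_axioms_def is_group free_eval_hom)
  show ?thesis
    unfolding relation_group_def
    by (intro subgroup.subgroup_is_group h.subgroup_kernel) simp
qed

abbreviation "Hom_relations \<equiv> hom_group (relation_group G) integer_group"

abbreviation "Hom_restrictions \<equiv>
  (\<lambda>f. restrict f (carrier (relation_group G))) ` carrier (hom_group (free_Abelian_group (carrier G)) integer_group)"

lemma Ext_eq: "Ext G integer_group = Hom_relations Mod Hom_restrictions"
  by (simp add: Ext_def)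

lemma comm_group_Hom_relations: "comm_group Hom_relations"
  by (intro comm_group_hom_group group_relation_group abelian_integer_group)

lemma subgroup_Hom_restrictions: "subgroup Hom_restrictions Hom_relations"
proof -
  let ?F = "hom_group (free_Abelian_group (carrier G)) integer_group"
  interpret F: comm_group ?F
    by (intro comm_group_hom_group abelian_integer_group) simp
  interpret R: comm_group Hom_relations
    by (rule comm_group_Hom_relations)
  have "(\<lambda>f. restrict f (carrier (relation_group G))) \<in> hom ?F Hom_relations"
    by (auto simp: hom_def hom_group_def carrier_relation_group free_eval_add keys_add_subset)
  then interpret h: group_hom ?F Hom_relations "\<lambda>f. restrict f (carrier (relation_group G))"
    by (simp add: group_hom_def group_hom_axioms_def F.is_group R.is_group)
  show ?thesis
    by (rule h.img_is_subgroup)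
qed

lemma comm_group_Ext: "comm_group (Ext G integer_group)"
  unfolding Ext_eq by (intro comm_group.abelian_FactGroup comm_group_Hom_relations subgroup_Hom_restrictions)

section \<open>From functions additive modulo the integers to extension classes\<close>

lemma lin_minus_free_eval_in_Ints:
  assumes u: "additive_mod_Ints G u" and c: "Poly_Mapping.keys c \<subseteq> carrier G"
  shows "lin u c - u (free_eval G c) \<in> \<int>"
  using c
proof (induction rule: free_Abelian_group_induct [consumes 1, case_names zero diff one])
  case zero
  have "u (\<one> \<otimes> \<one>) - (u \<one> + u \<one>) \<in> \<int>"
    using u unfolding additive_mod_Ints_def by blast
  then show ?case by simp
next
  case (diff c d)
  let ?c = "free_eval G c" and ?d = "free_eval G d"
  \<comment> \<open>Multiplying the quotient back by \<open>?d\<close> yields its value modulo the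
    integers without first computing \<open>u\<close> on an inverse.\<close>
  have "u ((?c \<otimes> inv ?d) \<otimes> ?d) - (u (?c \<otimes> inv ?d) + u ?d) \<in> \<int>"
    using u diff by (simp add: additive_mod_Ints_def)
  then have "u ?c - (u (?c \<otimes> inv ?d) + u ?d) \<in> \<int>"
    using diff by (simp add: m_assoc)
  from Ints_add [OF this Ints_diff [OF diff(3,4)]] show ?case
    using diff by (simp add: lin_diff free_eval_diff algebra_simps)
qed simp

text \<open>The relations saying that a product of two elements is the formal sum of its factors
  already encode additivity.\<close>

lemma additive_if_lin_relations_eq_0:
  assumes "\<And>c. c \<in> carrier (relation_group G) \<Longrightarrow> lin v c = 0"
  shows "additive G v"
  unfolding additive_def
proof (intro ballI)
  fix a b assume ab: "a \<in> carrier G" "b \<in> carrier G"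
  let ?c = "frag_of (a \<otimes> b) - (frag_of a + frag_of b)"
  have k: "Poly_Mapping.keys (frag_of a + frag_of b) \<subseteq> carrier G"
    using keys_add [of "frag_of a" "frag_of b"] ab by (auto simp: keys_frag_of)
  then have "?c \<in> carrier (relation_group G)"
    using keys_diff [of "frag_of (a \<otimes> b)" "frag_of a + frag_of b"] ab
    by (auto simp: carrier_relation_group free_eval_diff free_eval_add keys_frag_of)
  from assms [OF this] show "v (a \<otimes> b) = v a + v b"
    by (simp add: lin_diff lin_add)
qed

text \<open>When \<open>u\<close> is additive modulo the integers, \<open>lin u\<close> is integral
  on relations, so the floor only changes the type.\<close>

definition ext_cocycle :: "('a \<Rightarrow> rat) \<Rightarrow> ('a \<Rightarrow>\<^sub>0 int) \<Rightarrow> int" where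
  "ext_cocycle u = (\<lambda>c\<in>carrier (relation_group G). \<lfloor>lin u c\<rfloor>)"

definition ext_class :: "('a \<Rightarrow> rat) \<Rightarrow> (('a \<Rightarrow>\<^sub>0 int) \<Rightarrow> int) set" where
  "ext_class u = Hom_restrictions #>\<^bsub>Hom_relations\<^esub> ext_cocycle u"

lemma of_int_ext_cocycle:
  assumes "additive_mod_Ints G u" "c \<in> carrier (relation_group G)"
  shows "of_int (ext_cocycle u c) = lin u c"
proof -
  have "u \<one> \<in> \<int>"
    using lin_minus_free_eval_in_Ints [OF assms(1), of 0] by simp
  then have "lin u c \<in> \<int>"
    using lin_minus_free_eval_in_Ints [OF assms(1), of c] assms(2)
    by (auto simp: carrier_relation_group dest: Ints_add)
  then show ?thesis
    using assms(2) by (simp add: ext_cocycle_def of_int_floor)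
qed

lemma ext_cocycle_closed:
  assumes "additive_mod_Ints G u"
  shows "ext_cocycle u \<in> carrier Hom_relations"
proof -
  have "ext_cocycle u (c + d) = ext_cocycle u c + ext_cocycle u d"
    if "c \<in> carrier (relation_group G)" "d \<in> carrier (relation_group G)" for c d
  proof -
    have "c + d \<in> carrier (relation_group G)"
      using monoid.m_closed [OF group.is_monoid [OF group_relation_group] that] by simp
    then have "of_int (ext_cocycle u (c + d)) = (of_int (ext_cocycle u c + ext_cocycle u d) :: rat)"
      using that by (simp add: of_int_ext_cocycle [OF assms] lin_add)
    then show ?thesis by (simp only: of_int_eq_iff)
  qed
  then show ?thesis
    by (auto simp: hom_group_def hom_def ext_cocycle_def)
qed

lemma ext_class_closed:
  "additive_mod_Ints G u \<Longrightarrow> ext_class u \<in> carrier (Ext G integer_group)"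
  by (auto simp: Ext_eq carrier_FactGroup ext_class_def ext_cocycle_closed)

lemma Hom_relations_nat_pow:
  "h \<in> carrier Hom_relations \<Longrightarrow> c \<in> carrier (relation_group G) \<Longrightarrow>
    (h [^]\<^bsub>Hom_relations\<^esub> (n::nat)) c = int n * h c"
  by (induction n) (auto simp: hom_group_def algebra_simps)

lemma ext_class_nat_pow:
  assumes "additive_mod_Ints G u"
  shows "ext_class u [^]\<^bsub>Ext G integer_group\<^esub> (n::nat) =
    Hom_restrictions #>\<^bsub>Hom_relations\<^esub> (ext_cocycle u [^]\<^bsub>Hom_relations\<^esub> n)"
  unfolding Ext_eq ext_class_def
  by (intro normal.FactGroup_pow comm_group.normal_iff_subgroup [THEN iffD2] comm_group_Hom_relations
      subgroup_Hom_restrictions ext_cocycle_closed assms)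

text \<open>A homomorphism on the free group is the linear extension of its values \<open>w\<close>
  on the generators.\<close>

lemma Hom_restrictionsE:
  assumes "h \<in> Hom_restrictions"
  obtains w where "\<And>c. c \<in> carrier (relation_group G) \<Longrightarrow> h c = lin w c"
proof -
  obtain f where f: "f \<in> hom (free_Abelian_group (carrier G)) integer_group"
    and h: "h = restrict f (carrier (relation_group G))"
    using assms by (auto simp: hom_group_def)
  interpret f: group_hom "free_Abelian_group (carrier G)" integer_group f
    by (simp add: group_hom_def group_hom_axioms_def f)
  have "f c = lin (\<lambda>a. f (frag_of a)) c" if "Poly_Mapping.keys c \<subseteq> carrier G" for c
    using that
  proof (induction rule: free_Abelian_group_induct [consumes 1, case_names zero diff one])
    case zero
    then show ?case using f.hom_one by simp
  next
    case (diff c d)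
    then show ?case
      using f.hom_mult [of c "- d"] f.hom_inv [of d] by (simp add: lin_diff)
  qed simp
  then show thesis
    by (intro that [of "\<lambda>a. f (frag_of a)"]) (auto simp: h carrier_relation_group)
qed

text \<open>Coincidence of the classes means that \<open>n\<close> times the difference of the
  cocycles extends to the free group, hence is \<open>lin w\<close> for an integral
  \<open>w\<close>. Subtracting \<open>w\<close> leaves a function whose linear extension kills all
  relations.\<close>

lemma ext_class_pow_eq_imp_additive:
  assumes u: "additive_mod_Ints G u" and v: "additive_mod_Ints G v"
    and eq: "ext_class u [^]\<^bsub>Ext G integer_group\<^esub> (n::nat) = ext_class v [^]\<^bsub>Ext G integer_group\<^esub> n"
  obtains w :: "'a \<Rightarrow> int" where "additive G (\<lambda>a. of_nat n * (u a - v a) - of_int (w a))"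
proof -
  interpret H: comm_group Hom_relations by (rule comm_group_Hom_relations)
  let ?u = "ext_cocycle u [^]\<^bsub>Hom_relations\<^esub> n" and ?v = "ext_cocycle v [^]\<^bsub>Hom_relations\<^esub> n"
  have "?u \<in> Hom_restrictions #>\<^bsub>Hom_relations\<^esub> ?u"
    by (intro H.rcos_self H.nat_pow_closed ext_cocycle_closed u subgroup_Hom_restrictions)
  also have "\<dots> = Hom_restrictions #>\<^bsub>Hom_relations\<^esub> ?v"
    using eq by (simp add: ext_class_nat_pow u v)
  finally obtain h where h: "h \<in> Hom_restrictions" "?u = h \<otimes>\<^bsub>Hom_relations\<^esub> ?v"
    unfolding r_coset_def by auto
  from Hom_restrictionsE [OF h(1)] obtain w where
    w: "\<And>c. c \<in> carrier (relation_group G) \<Longrightarrow> h c = lin w c" by metis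
  have "lin (\<lambda>a. of_nat n * (u a - v a) - of_int (w a)) c = 0" if c: "c \<in> carrier (relation_group G)" for c
  proof -
    have "?u c = h c + ?v c"
      using c h(2) by (simp add: hom_group_def)
    then have "int n * ext_cocycle u c = lin w c + int n * ext_cocycle v c"
      using c by (simp add: Hom_relations_nat_pow ext_cocycle_closed u v w)
    then have "(of_int (int n * ext_cocycle u c) :: rat) = of_int (lin w c + int n * ext_cocycle v c)"
      by (simp only:)
    then show ?thesis
      using c by (simp add: of_int_ext_cocycle u v lin_fun_diff lin_fun_mult lin_of_int right_diff_distrib)
  qed
  then show thesis
    by (intro that additive_if_lin_relations_eq_0)
qed

text \<open>The integral values of \<open>n\<close> times \<open>u\<close> on the generators extend
  the multiplied cocycle to the whole free group.\<close>

lemma ext_class_pow_eq_one: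
  assumes u: "additive_mod_Ints G u" and int: "\<And>a. a \<in> carrier G \<Longrightarrow> of_nat n * u a \<in> \<int>"
  shows "ext_class u [^]\<^bsub>Ext G integer_group\<^esub> n = \<one>\<^bsub>Ext G integer_group\<^esub>"
proof -
  interpret H: comm_group Hom_relations by (rule comm_group_Hom_relations)
  let ?u = "ext_cocycle u [^]\<^bsub>Hom_relations\<^esub> n"
  let ?f = "\<lambda>c\<in>carrier (free_Abelian_group (carrier G)). lin (\<lambda>a. \<lfloor>of_nat n * u a\<rfloor>) c"
  have uc: "?u \<in> carrier Hom_relations"
    by (intro H.nat_pow_closed ext_cocycle_closed u)
  have "?f \<in> carrier (hom_group (free_Abelian_group (carrier G)) integer_group)"
    by (auto simp: hom_group_def hom_def lin_add keys_add_subset)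
  moreover have "restrict ?f (carrier (relation_group G)) = ?u"
  proof (rule extensionalityI [of _ "carrier (relation_group G)"])
    show "?u \<in> extensional (carrier (relation_group G))"
      using uc by (simp add: hom_group_def)
    fix c assume c: "c \<in> carrier (relation_group G)"
    then have k: "Poly_Mapping.keys c \<subseteq> carrier G"
      by (simp add: carrier_relation_group)
    have "(of_int (lin (\<lambda>a. \<lfloor>of_nat n * u a\<rfloor>) c) :: rat) = lin (\<lambda>a. of_nat n * u a) c"
      unfolding lin_def using int k by (auto simp: of_int_floor intro!: sum.cong)
    also have "\<dots> = of_int (int n * ext_cocycle u c)"
      using c by (simp add: of_int_ext_cocycle u lin_fun_mult)
    finally have "lin (\<lambda>a. \<lfloor>of_nat n * u a\<rfloor>) c = int n * ext_cocycle u c"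
      by (simp only: of_int_eq_iff)
    then show "restrict ?f (carrier (relation_group G)) c = ?u c"
      using c k by (simp add: Hom_relations_nat_pow ext_cocycle_closed u)
  qed (rule restrict_extensional)
  ultimately have "?u \<in> Hom_restrictions"
    by (metis (no_types, lifting) image_eqI)
  then show ?thesis
    unfolding ext_class_nat_pow [OF u] unfolding Ext_eq one_FactGroup
    by (intro H.coset_join2 uc subgroup_Hom_restrictions)
qed

end

subsection \<open>Independence modulo a subgroup and functionals\<close>

text \<open>One notion for two situations: for \<open>q = 0\<close> all coefficients must vanish,
  which is independence over the integers modulo \<open>K\<close>; for a prime \<open>q\<close>,
  with \<open>K\<close> containing all \<open>q\<close>-th powers, it is linear independence over
  the field with \<open>q\<close> elements.\<close>

definition independent_mod :: "('a, 'm) monoid_scheme \<Rightarrow> int \<Rightarrow> 'a set \<Rightarrow> 'a set \<Rightarrow> bool" where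
  "independent_mod G q K X \<longleftrightarrow> X \<subseteq> carrier G \<and>
     (\<forall>c. Poly_Mapping.keys c \<subseteq> X \<longrightarrow> free_eval G c \<in> K \<longrightarrow> (\<forall>x. q dvd Poly_Mapping.lookup c x))"

lemma ex_maximal_independent_mod:
  "\<exists>X. independent_mod G q K X \<and> (\<forall>Y. independent_mod G q K Y \<longrightarrow> X \<subseteq> Y \<longrightarrow> Y = X)"
proof -
  let ?F = "{X. independent_mod G q K X}"
  have "\<exists>X\<in>?F. \<forall>Y\<in>?F. X \<subseteq> Y \<longrightarrow> Y = X"
  proof (rule subset_Zorn_nonempty)
    show "?F \<noteq> {}"
      by (auto simp: independent_mod_def intro!: exI [of _ "{}"])
    fix C assume ne: "C \<noteq> {}" and C: "subset.chain ?F C"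
    then have CF: "C \<subseteq> ?F"
      by (auto simp: subset.chain_def)
    have "q dvd Poly_Mapping.lookup c x"
      if c: "Poly_Mapping.keys c \<subseteq> \<Union>C" "free_eval G c \<in> K" for c x
    proof -
      obtain X where "X \<in> C" "Poly_Mapping.keys c \<subseteq> X"
        using finite_subset_Union_chain [OF finite_keys c(1) ne C] by blast
      then show ?thesis
        using CF c(2) by (auto simp: independent_mod_def)
    qed
    then show "\<Union>C \<in> ?F"
      using CF by (auto simp: independent_mod_def)
  qed
  then show ?thesis by auto
qed

section \<open>Functionals with prescribed values on a maximal independent set\<close>

locale maximal_independent_mod = comm_group G for G :: "('a, 'm) monoid_scheme" (structure) +
  fixes q :: int and K X :: "'a set"
  assumes subgroup_K: "subgroup K G"
    and prime_or_0: "prime q \<or> q = 0"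
    and pow_in_K: "a \<in> carrier G \<Longrightarrow> a [^] q \<in> K"
    and independent_X: "independent_mod G q K X"
    and maximal_X: "independent_mod G q K Y \<Longrightarrow> X \<subseteq> Y \<Longrightarrow> Y = X"
begin

lemma X_subset: "X \<subseteq> carrier G"
  using independent_X by (simp add: independent_mod_def)

lemma K_subset: "K \<subseteq> carrier G"
  using subgroup.subset [OF subgroup_K] .

text \<open>Modulo \<open>K\<close>, the element \<open>a\<close> is the combination
  \<open>c\<close> divided by \<open>n\<close>. The denominator is kept as data because it need not
  be invertible in the group.\<close>

definition rep :: "'a \<Rightarrow> int \<Rightarrow> ('a \<Rightarrow>\<^sub>0 int) \<Rightarrow> bool" where
  "rep a n c \<longleftrightarrow> a \<in> carrier G \<and> Poly_Mapping.keys c \<subseteq> X \<and> (\<exists>k\<in>K. a [^] n = free_eval G c \<otimes> k)"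

lemma K_int_pow: "k \<in> K \<Longrightarrow> k [^] (n :: int) \<in> K"
  by (rule subgroup_int_pow_closed [OF subgroup_K])

lemma rep_scale:
  assumes "rep a n c"
  shows "rep a (t * n) (frag_cmul t c)"
proof -
  from assms obtain k where k: "k \<in> K" "a [^] n = free_eval G c \<otimes> k" and a: "a \<in> carrier G"
    and c: "Poly_Mapping.keys c \<subseteq> X" by (auto simp: rep_def)
  have cG: "Poly_Mapping.keys c \<subseteq> carrier G" and kG: "k \<in> carrier G"
    using c X_subset k K_subset by auto
  have "a [^] (t * n) = (a [^] n) [^] t"
    using a by (simp add: int_pow_pow mult.commute)
  also have "\<dots> = free_eval G (frag_cmul t c) \<otimes> k [^] t"
    using cG kG by (simp add: k int_pow_distrib free_eval_cmul)
  finally show ?thesis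
    using a c k(1) K_int_pow keys_cmul [of t c] by (auto simp: rep_def)
qed

lemma rep_add:
  assumes "rep a n c" "rep b n d"
  shows "rep (a \<otimes> b) n (c + d)"
proof -
  from assms obtain k l where k: "k \<in> K" "a [^] n = free_eval G c \<otimes> k" and l: "l \<in> K" "b [^] n = free_eval G d \<otimes> l"
    and ab: "a \<in> carrier G" "b \<in> carrier G"
    and cd: "Poly_Mapping.keys c \<subseteq> X" "Poly_Mapping.keys d \<subseteq> X" by (auto simp: rep_def)
  have G: "Poly_Mapping.keys c \<subseteq> carrier G" "Poly_Mapping.keys d \<subseteq> carrier G" "k \<in> carrier G" "l \<in> carrier G"
    using cd X_subset k l K_subset by auto
  have "(a \<otimes> b) [^] n = (free_eval G c \<otimes> k) \<otimes> (free_eval G d \<otimes> l)"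
    using ab by (simp add: int_pow_distrib k l)
  also have "\<dots> = free_eval G (c + d) \<otimes> (k \<otimes> l)"
    using G by (simp add: free_eval_add m_ac)
  finally show ?thesis
    using ab cd subgroup.m_closed [OF subgroup_K k(1) l(1)] by (auto simp: rep_def keys_add_subset)
qed

text \<open>Two numerators over the same denominator differ by a formal sum evaluating into
  \<open>K\<close>, so independence makes its coefficients divisible by \<open>q\<close>.\<close>

lemma rep_unique:
  assumes "rep a n c" "rep a n d"
  shows "q dvd lin f c - lin f d"
proof -
  from assms obtain k l where k: "k \<in> K" "a [^] n = free_eval G c \<otimes> k" and l: "l \<in> K" "a [^] n = free_eval G d \<otimes> l"
    and cd: "Poly_Mapping.keys c \<subseteq> X" "Poly_Mapping.keys d \<subseteq> X" by (auto simp: rep_def)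
  have G: "Poly_Mapping.keys c \<subseteq> carrier G" "Poly_Mapping.keys d \<subseteq> carrier G" "k \<in> carrier G" "l \<in> carrier G"
    using cd X_subset k l K_subset by auto
  have "free_eval G c = free_eval G d \<otimes> l \<otimes> inv k"
    using G k l inv_solve_right [of "free_eval G c" "free_eval G d \<otimes> l" k] by simp
  then have "free_eval G (c - d) = l \<otimes> inv k"
    using G inv_solve_right [of "l \<otimes> inv k" "free_eval G c" "free_eval G d"]
    by (simp add: free_eval_diff m_ac)
  also have "\<dots> \<in> K"
    using k l subgroup_K by (simp add: subgroup_def)
  finally have "q dvd Poly_Mapping.lookup (c - d) x" for x
    using independent_X cd by (simp add: independent_mod_def keys_diff_subset)
  then have "q dvd lin f (c - d)"
    by (rule dvd_lin)
  then show ?thesis by (simp add: lin_diff)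
qed

text \<open>Additivity with denominators cleared: everything is brought to the common denominator
  \<open>n * m * l\<close>, where \<open>rep_unique\<close> applies.\<close>

lemma rep_additive:
  assumes "rep a n c" "rep b m d" "rep (a \<otimes> b) l e"
  shows "q dvd m * l * lin f c + n * l * lin f d - n * m * lin f e"
proof -
  have "rep (a \<otimes> b) (n * m * l) (frag_cmul (m * l) c + frag_cmul (n * l) d)"
    using rep_add [of a "n * m * l" "frag_cmul (m * l) c" b "frag_cmul (n * l) d"]
      rep_scale [OF assms(1), of "m * l"] rep_scale [OF assms(2), of "n * l"]
    by (simp add: mult_ac)
  from rep_unique [OF this rep_scale [OF assms(3)], of f] show ?thesis
    by (simp add: lin_add lin_cmul)
qed

lemma rep_base: "x \<in> X \<Longrightarrow> rep x 1 (frag_of x)"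
  using X_subset subgroup.one_closed [OF subgroup_K] by (auto simp: rep_def keys_frag_of intro!: bexI [of _ \<one>])

lemma rep_K: "k \<in> K \<Longrightarrow> rep k 1 0"
  using K_subset by (auto simp: rep_def intro!: bexI [of _ k])

text \<open>If \<open>a\<close> is not in \<open>X\<close>, maximality yields a combination in
  \<open>K\<close> with some coefficient not divisible by \<open>q\<close>. Were the coefficient of
  \<open>a\<close> divisible, that power of \<open>a\<close> would lie in \<open>K\<close> and could
  be dropped, contradicting independence of \<open>X\<close>.\<close>

lemma ex_rep:
  assumes a: "a \<in> carrier G"
  shows "\<exists>n c. \<not> q dvd n \<and> rep a n c"
proof (cases "a \<in> X")
  case True
  then show ?thesis
    using rep_base prime_or_0 not_prime_unit [of q] by (intro exI [of _ 1] exI [of _ "frag_of a"]) auto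
next
  case False
  then have "\<not> independent_mod G q K (insert a X)"
    using maximal_X [of "insert a X"] by blast
  then obtain c x where c: "Poly_Mapping.keys c \<subseteq> insert a X" "free_eval G c \<in> K"
    and x: "\<not> q dvd Poly_Mapping.lookup c x"
    using a X_subset by (auto simp: independent_mod_def)
  define m where "m = Poly_Mapping.lookup c a"
  define d where "d = c - frag_cmul m (frag_of a)"
  have cG: "Poly_Mapping.keys c \<subseteq> carrier G"
    using c a X_subset by auto
  have lookup_d: "Poly_Mapping.lookup d y = (if y = a then 0 else Poly_Mapping.lookup c y)" for y
    by (simp add: d_def lookup_minus m_def)
  then have dX: "Poly_Mapping.keys d \<subseteq> X"
    using c(1) by (auto simp: in_keys_iff split: if_splits)
  then have dG: "Poly_Mapping.keys d \<subseteq> carrier G"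
    using X_subset by auto
  have "Poly_Mapping.keys (frag_cmul m (frag_of a)) \<subseteq> carrier G"
    using a keys_cmul [of m "frag_of a"] by (auto simp: keys_frag_of)
  then have ev: "free_eval G c = free_eval G d \<otimes> a [^] m"
    using a dG free_eval_add [of d "frag_cmul m (frag_of a)"]
    by (simp add: d_def free_eval_cmul keys_frag_of)
  have "\<not> q dvd m"
  proof
    assume "q dvd m"
    then obtain t where "m = q * t" ..
    then have "a [^] m = (a [^] q) [^] t"
      using a by (simp add: int_pow_pow)
    then have am: "a [^] m \<in> K"
      using pow_in_K [OF a] K_int_pow by simp
    have "free_eval G d = free_eval G c \<otimes> inv (a [^] m)"
      using ev a dG by (simp add: m_assoc)
    also have "\<dots> \<in> K"
      using c(2) am subgroup_K by (simp add: subgroup_def)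
    finally have "q dvd Poly_Mapping.lookup d x"
      using independent_X dX by (simp add: independent_mod_def)
    with x \<open>q dvd m\<close> show False
      by (auto simp: lookup_d m_def split: if_splits)
  qed
  moreover have "rep a m (- d)"
    unfolding rep_def
  proof (intro conjI bexI)
    show "a [^] m = free_eval G (- d) \<otimes> free_eval G c"
      using ev a dG by (simp add: free_eval_minus inv_solve_left)
  qed (use a c dX in auto)
  ultimately show ?thesis by blast
qed

text \<open>The value at \<open>a\<close> is the fraction read off from a representation of
  \<open>a\<close>; for \<open>q = 0\<close> the divisibilities above are equations.\<close>

lemma ex_rational_functional:
  assumes "q = 0"
  shows "\<exists>h. additive G h \<and> (\<forall>x\<in>X. h x = of_int (f x)) \<and> (\<forall>k\<in>K. h k = 0)"
proof -
  obtain N C where N: "\<And>a. a \<in> carrier G \<Longrightarrow> N a \<noteq> 0" and rep: "\<And>a. a \<in> carrier G \<Longrightarrow> rep a (N a) (C a)"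
    using ex_rep assms by (metis dvd_0_left_iff)
  define h :: "'a \<Rightarrow> rat" where "h a = of_int (lin f (C a)) / of_int (N a)" for a
  have "h (a \<otimes> b) = h a + h b" if ab: "a \<in> carrier G" "b \<in> carrier G" for a b
  proof -
    have "N b * N (a \<otimes> b) * lin f (C a) + N a * N (a \<otimes> b) * lin f (C b) - N a * N b * lin f (C (a \<otimes> b)) = 0"
      using rep_additive [OF rep rep rep, of a b f] ab assms by simp
    then have "(of_int (N b * N (a \<otimes> b) * lin f (C a) + N a * N (a \<otimes> b) * lin f (C b)) :: rat)
      = of_int (N a * N b * lin f (C (a \<otimes> b)))"
      by simp
    then show ?thesis
      using N [of a] N [of b] N [of "a \<otimes> b"] ab by (simp add: h_def field_simps)
  qed
  moreover have "h x = of_int (f x)" if "x \<in> X" for x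
  proof -
    have x: "x \<in> carrier G" using that X_subset by auto
    have "lin f (C x) = N x * f x"
      using rep_unique [OF rep [OF x] rep_scale [OF rep_base [OF that], of "N x", simplified], of f] assms
      by (simp add: lin_cmul)
    then show ?thesis
      using N [OF x] by (simp add: h_def)
  qed
  moreover have "h k = 0" if "k \<in> K" for k
  proof -
    have k: "k \<in> carrier G" using that K_subset by auto
    have "lin f (C k) = 0"
      using rep_unique [OF rep [OF k] rep_scale [OF rep_K [OF that], of "N k", simplified], of f] assms
      by simp
    then show ?thesis by (simp add: h_def)
  qed
  ultimately show ?thesis
    unfolding additive_def by blast
qed

text \<open>The same construction with the division carried out modulo \<open>q\<close>, where the
  denominators are invertible.\<close>

lemma ex_modular_functional:
  assumes q: "prime q"
  shows "\<exists>h. (\<forall>a\<in>carrier G. \<forall>b\<in>carrier G. q dvd h (a \<otimes> b) - (h a + h b)) \<and> (\<forall>x\<in>X. q dvd h x - f x)"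
proof -
  obtain N C where N: "\<And>a. a \<in> carrier G \<Longrightarrow> \<not> q dvd N a" and rep: "\<And>a. a \<in> carrier G \<Longrightarrow> rep a (N a) (C a)"
    using ex_rep by metis
  have "\<exists>s. q dvd N a * s - lin f (C a)" if "a \<in> carrier G" for a
  proof -
    have "coprime (N a) q"
      using prime_imp_coprime [OF q N [OF that]] by (simp add: coprime_commute)
    then obtain u v where uv: "u * N a + v * q = 1"
      using bezout_int [of "N a" q] by auto
    have "N a * (u * lin f (C a)) - lin f (C a) = (u * N a - 1) * lin f (C a)"
      by (simp add: algebra_simps)
    also have "u * N a - 1 = q * (- v)"
      using uv by (simp add: algebra_simps)
    finally show ?thesis
      by (metis dvd_triv_left mult.assoc)
  qed
  then obtain h where h: "\<And>a. a \<in> carrier G \<Longrightarrow> q dvd N a * h a - lin f (C a)"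
    by metis
  have "q dvd h (a \<otimes> b) - (h a + h b)" if ab: "a \<in> carrier G" "b \<in> carrier G" for a b
  proof -
    let ?n = "N a" and ?m = "N b" and ?l = "N (a \<otimes> b)"
    have 1: "q dvd ?m * ?l * lin f (C a) + ?n * ?l * lin f (C b) - ?n * ?m * lin f (C (a \<otimes> b))"
      using rep_additive [OF rep rep rep] ab by simp
    have 2: "q dvd ?m * ?l * (?n * h a - lin f (C a)) + ?n * ?l * (?m * h b - lin f (C b))
        - ?n * ?m * (?l * h (a \<otimes> b) - lin f (C (a \<otimes> b)))"
      using h [of a] h [of b] h [of "a \<otimes> b"] ab
      by (intro dvd_diff dvd_add; intro dvd_mult) auto
    have "q dvd ?n * ?m * ?l * (h (a \<otimes> b) - (h a + h b))"
      using dvd_add [OF 1 2] by (subst dvd_minus_iff [symmetric]) (simp add: algebra_simps)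
    then show ?thesis
      using N [of a] N [of b] N [of "a \<otimes> b"] ab q by (simp add: prime_dvd_mult_iff)
  qed
  moreover have "q dvd h x - f x" if "x \<in> X" for x
  proof -
    have x: "x \<in> carrier G" using that X_subset by auto
    have 1: "q dvd lin f (C x) - N x * f x"
      using rep_unique [OF rep [OF x] rep_scale [OF rep_base [OF that], of "N x", simplified], of f]
      by (simp add: lin_cmul)
    have "q dvd N x * (h x - f x)"
      using dvd_add [OF 1 h [OF x]] by (simp add: algebra_simps)
    then show ?thesis
      using N [OF x] q by (simp add: prime_dvd_mult_iff)
  qed
  ultimately show ?thesis by blast
qed

lemma free_eval_in_generate: "Poly_Mapping.keys c \<subseteq> X \<Longrightarrow> free_eval G c \<in> generate G X"
  unfolding free_eval_def using X_subset by (intro finprod_pow_in_generate) auto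

text \<open>Each \<open>a\<close> has a power with nonzero exponent in the subgroup generated by
  \<open>X\<close> and \<open>K\<close>. Torsion-freeness makes \<open>a\<close> recoverable from
  the exponent and the power.\<close>

lemma card_of_carrier_le:
  assumes "q = 0" and tf: "torsion_free G" and Z: "infinite Z" "|X| \<le>o |Z|" "|K| \<le>o |Z|"
  shows "|carrier G| \<le>o |Z|"
proof -
  obtain N C where N: "\<And>a. a \<in> carrier G \<Longrightarrow> N a \<noteq> 0" and rep: "\<And>a. a \<in> carrier G \<Longrightarrow> rep a (N a) (C a)"
    using ex_rep assms by (metis dvd_0_left_iff)
  let ?H = "generate G (X \<union> K)"
  have XK: "X \<union> K \<subseteq> carrier G"
    using X_subset K_subset by auto
  have in_H: "a [^] N a \<in> ?H" if "a \<in> carrier G" for a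
  proof -
    from rep [OF that] obtain k where "k \<in> K" "a [^] N a = free_eval G (C a) \<otimes> k" "Poly_Mapping.keys (C a) \<subseteq> X"
      by (auto simp: rep_def)
    moreover have "generate G X \<subseteq> ?H" "K \<subseteq> ?H"
      using mono_generate [of X "X \<union> K"] by (auto intro: generate.incl)
    ultimately show ?thesis
      using free_eval_in_generate by (auto intro!: generate.eng)
  qed
  have "inj_on (\<lambda>a. (N a, a [^] N a)) (carrier G)"
  proof (rule inj_onI)
    fix a b assume ab: "a \<in> carrier G" "b \<in> carrier G" and eq: "(N a, a [^] N a) = (N b, b [^] N b)"
    let ?c = "a \<otimes> inv b"
    have c: "?c \<in> carrier G" using ab by simp
    have "a [^] N a = b [^] N a"
      using eq by auto
    then have "?c [^] N a = \<one>"
      using ab by (simp add: int_pow_distrib int_pow_inv)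
    then have "int (ord ?c) dvd N a"
      using int_pow_eq_id [OF c] by simp
    then have "ord ?c dvd nat \<bar>N a\<bar>"
      by (simp add: int_dvd_int_iff [symmetric])
    then have "?c [^] nat \<bar>N a\<bar> = \<one>"
      by (simp only: pow_eq_id [OF c])
    moreover have "nat \<bar>N a\<bar> > 0"
      using N [OF ab(1)] by simp
    ultimately have "?c = \<one>"
      using tf c unfolding torsion_free_def by blast
    then show "a = b"
      using ab inv_solve_right [of \<one> a b] by simp
  qed
  then have "|carrier G| \<le>o |(UNIV :: int set) \<times> ?H|"
    using in_H by (intro card_of_ordLeqI [where f = "\<lambda>a. (N a, a [^] N a)"]) auto
  also have "|(UNIV :: int set) \<times> ?H| \<le>o |Z|"
  proof (rule card_of_Times_ordLeq_infinite)
    show "|UNIV :: int set| \<le>o |Z|"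
      using Z(1) infinite_iff_card_of_countable [of "UNIV :: int set" Z] by simp
    have "|X \<union> K| \<le>o |Z|"
      using Z by (intro card_of_Un_ordLeq_infinite)
    then show "|?H| \<le>o |Z|"
      using XK Z(1) by (intro card_of_generate_le)
  qed (rule Z(1))
  finally show ?thesis .
qed

text \<open>A representation controls only a power of \<open>a\<close> with exponent prime to
  \<open>q\<close>; a Bezout combination with \<open>q\<close> recovers \<open>a\<close>
  itself.\<close>

lemma ex_pow_mult_generate:
  assumes q: "prime q" and K: "K = (\<lambda>y. y [^] q) ` carrier G" and a: "a \<in> carrier G"
  shows "\<exists>g\<in>generate G X. \<exists>y\<in>carrier G. a = y [^] q \<otimes> g"
proof -
  obtain n c where n: "\<not> q dvd n" and "rep a n c"
    using ex_rep [OF a] by blast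
  then obtain k where c: "Poly_Mapping.keys c \<subseteq> X" and k: "k \<in> K" "a [^] n = free_eval G c \<otimes> k"
    by (auto simp: rep_def)
  then obtain z where z: "z \<in> carrier G" "a [^] n = free_eval G c \<otimes> z [^] q"
    using K by auto
  have ev: "free_eval G c \<in> carrier G"
    using c X_subset by simp
  have "coprime n q"
    using prime_imp_coprime [OF q n] by (simp add: coprime_commute)
  then obtain u v where uv: "u * n + v * q = 1"
    using bezout_int [of n q] by auto
  have "a = a [^] (n * u + v * q)"
    using uv a by (simp add: mult.commute)
  also have "\<dots> = (a [^] n) [^] u \<otimes> (a [^] v) [^] q"
    using a by (simp add: int_pow_mult int_pow_pow)
  also have "\<dots> = (free_eval G c [^] u \<otimes> (z [^] q) [^] u) \<otimes> (a [^] v) [^] q"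
    using ev z by (simp add: int_pow_distrib)
  also have "(z [^] q) [^] u = (z [^] u) [^] q"
    using z by (simp add: int_pow_pow mult.commute)
  also have "(free_eval G c [^] u \<otimes> (z [^] u) [^] q) \<otimes> (a [^] v) [^] q = (z [^] u \<otimes> a [^] v) [^] q \<otimes> free_eval G c [^] u"
    using a z ev by (simp add: int_pow_distrib m_ac)
  finally have "a = (z [^] u \<otimes> a [^] v) [^] q \<otimes> free_eval G c [^] u" .
  moreover have "free_eval G c [^] u \<in> generate G X"
    using c X_subset by (intro subgroup_int_pow_closed generate_is_subgroup free_eval_in_generate)
  ultimately show ?thesis
    using a z by (metis int_pow_closed m_closed)
qed

end

subsection \<open>An irrational twist of the rationals\<close>

text \<open>Every positive integer divides almost all terms of the sequence below, so its series converges in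
  every ring of \<open>r\<close>-adic integers; for \<open>r = p\<close> the convergence is so fast that the limit is irrational.
  Multiplication by the limit is a homomorphism \<open>\<rat> \<rightarrow> \<rat>/\<int>\<close>. It is lifted to \<open>\<rat>\<close> by truncating the series
  at the denominator of the argument, beyond which all terms contribute integers.\<close>

primrec lacunary :: "nat \<Rightarrow> nat \<Rightarrow> nat" where
  "lacunary p 0 = 1"
| "lacunary p (Suc k) = Suc k * lacunary p k * p ^ (2 * lacunary p k)"

definition twist :: "nat \<Rightarrow> rat \<Rightarrow> rat" where
  "twist p x = x * of_nat (\<Sum>i<nat (snd (quotient_of x)). lacunary p i)"

lemma lacunary_dvd: "i \<le> j \<Longrightarrow> lacunary p i dvd lacunary p j"
proof (induction j)
  case (Suc j)
  have "lacunary p j dvd lacunary p (Suc j)"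
    by simp
  with Suc show ?case
    by (cases "i = Suc j") (auto simp del: lacunary.simps intro: dvd_trans)
qed simp

lemma dvd_lacunary:
  assumes "0 < n" "n \<le> i"
  shows "n dvd lacunary p i"
proof -
  obtain m where "n = Suc m" using assms(1) by (cases n) auto
  then have "n dvd lacunary p n" by (simp add: mult.assoc del: mult_Suc)
  then show ?thesis using lacunary_dvd [OF assms(2)] dvd_trans by blast
qed

lemma mult_lacunary_sum_diff:
  fixes x :: rat
  assumes "k \<le> m" "\<And>i. k \<le> i \<Longrightarrow> x * of_nat (lacunary p i) \<in> \<int>"
  shows "x * of_nat (\<Sum>i<m. lacunary p i) - x * of_nat (\<Sum>i<k. lacunary p i) \<in> \<int>"
  using assms(1)
proof (induction m)
  case (Suc m)
  show ?case
  proof (cases "k = Suc m")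
    case False
    with Suc have "x * of_nat (\<Sum>i<m. lacunary p i) - x * of_nat (\<Sum>i<k. lacunary p i) \<in> \<int>" "k \<le> m"
      by auto
    from Ints_add [OF this(1) assms(2) [OF this(2)]] show ?thesis
      by (simp add: algebra_simps)
  qed simp
qed simp

lemma mult_lacunary_in_Ints:
  assumes "nat (snd (quotient_of x)) \<le> i"
  shows "x * of_nat (lacunary p i) \<in> \<int>"
proof -
  obtain n m where nm: "quotient_of x = (n, m)" by force
  then have m: "m > 0" "x = of_int n / of_int m"
    using quotient_of_denom_pos quotient_of_div by auto
  then have "nat m dvd lacunary p i"
    using assms nm by (intro dvd_lacunary) auto
  then obtain t where "lacunary p i = nat m * t" ..
  then have "x * of_nat (lacunary p i) = of_int (n * int t)"
    using m by simp
  then show ?thesis by (metis Ints_of_int)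
qed

text \<open>Truncation may happen anywhere beyond which the terms contribute integers, possibly long
  before the denominator of \<open>x\<close>. The irrationality proof depends on such early
  truncation.\<close>

lemma twist_eq_mod_Ints:
  assumes "\<And>i. k \<le> i \<Longrightarrow> x * of_nat (lacunary p i) \<in> \<int>"
  shows "twist p x - x * of_nat (\<Sum>i<k. lacunary p i) \<in> \<int>"
proof -
  let ?m = "nat (snd (quotient_of x))"
  consider "k \<le> ?m" | "?m \<le> k" by linarith
  then show ?thesis
  proof cases
    case 1
    then show ?thesis
      using mult_lacunary_sum_diff [OF 1 assms] by (simp add: twist_def)
  next
    case 2
    then show ?thesis
      using Ints_minus [OF mult_lacunary_sum_diff [OF 2 mult_lacunary_in_Ints]] by (simp add: twist_def)
  qed
qed

text \<open>Truncated at a common place, the twist is multiplication by a fixed number.\<close>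

lemma twist_add_mod_Ints: "twist p (x + y) - (twist p x + twist p y) \<in> \<int>"
proof -
  define k where "k = max (nat (snd (quotient_of (x + y)))) (max (nat (snd (quotient_of x))) (nat (snd (quotient_of y))))"
  let ?S = "of_nat (\<Sum>i<k. lacunary p i) :: rat"
  have "twist p z - z * ?S \<in> \<int>" if "z \<in> {x + y, x, y}" for z
    using that by (intro twist_eq_mod_Ints mult_lacunary_in_Ints) (auto simp: k_def)
  then have *: "twist p (x + y) - (x + y) * ?S \<in> \<int>" "twist p x - x * ?S \<in> \<int>" "twist p y - y * ?S \<in> \<int>"
    by auto
  have "twist p (x + y) - (twist p x + twist p y) =
      (twist p (x + y) - (x + y) * ?S) - (twist p x - x * ?S) - (twist p y - y * ?S)"
    by (simp add: algebra_simps)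
  then show ?thesis using * by (metis Ints_diff)
qed

lemma twist_0 [simp]: "twist p 0 = 0"
  by (simp add: twist_def)

lemma lacunary_pos: "2 \<le> p \<Longrightarrow> 0 < lacunary p k"
  by (induction k) auto

lemma lacunary_ge: "2 \<le> p \<Longrightarrow> k \<le> lacunary p k"
  by (cases k) (auto intro!: dvd_imp_le dvd_lacunary lacunary_pos simp del: lacunary.simps)

text \<open>Each term is at least twice its predecessor, so the last one dominates the sum.\<close>

lemma lacunary_sum_le:
  assumes "2 \<le> p"
  shows "(\<Sum>i<Suc k. lacunary p i) \<le> 2 * lacunary p k"
proof (induction k)
  case (Suc k)
  have "2 \<le> p ^ (2 * lacunary p k)"
    using assms lacunary_pos [OF assms, of k] self_le_power [of p "2 * lacunary p k"] by linarith
  then have "2 * lacunary p k \<le> lacunary p k * p ^ (2 * lacunary p k)"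
    by simp
  also have "\<dots> \<le> lacunary p (Suc k)"
    by simp
  finally show ?case
    using Suc by simp
qed simp

text \<open>The hypothesis says that \<open>M\<close> and \<open>n\<close> times the limit agree
  modulo every power of \<open>p\<close>. For large \<open>k\<close>, the modulus
  \<open>p ^ (2 * lacunary p k)\<close> sees only the first \<open>k + 1\<close> terms and exceeds
  the remaining difference, which is therefore zero. This cannot hold for two consecutive
  \<open>k\<close>.\<close>

lemma twist_irrational:
  fixes M :: rat
  assumes p: "2 \<le> p" and n: "0 < (n :: nat)"
    and int: "\<And>j. M / of_nat p ^ j - of_nat n * twist p (1 / of_nat p ^ j) \<in> \<int>"
  shows False
proof -
  let ?S = "\<lambda>k. \<Sum>i<k. lacunary p i"
  \<comment> \<open>As \<open>twist p 1\<close> is an integer, the case \<open>j = 0\<close> of the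
    hypothesis forces \<open>M\<close> to be one.\<close>
  have "twist p 1 \<in> \<int>"
    by (auto simp: twist_def)
  then have "of_nat n * twist p 1 \<in> \<int>"
    by (intro Ints_mult) auto
  with int [of 0] have "M \<in> \<int>"
    by (metis Ints_add diff_add_cancel div_by_1 power_0)
  then obtain m where m: "M = of_int m"
    by (auto elim: Ints_cases)
  have eq: "m = int n * int (?S (Suc k))" if k: "nat \<bar>m\<bar> + 2 * n \<le> k" for k
  proof -
    let ?d = "lacunary p k"
    let ?P = "of_nat p ^ (2 * ?d) :: rat"
    have P: "?P \<noteq> 0" using p by simp
    \<comment> \<open>The recursion builds the factor \<open>p ^ (2 * ?d)\<close> into the term at
      \<open>Suc k\<close>, and later terms inherit it.\<close>
    have "1 / ?P * of_nat (lacunary p i) \<in> \<int>" if "Suc k \<le> i" for i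
    proof -
      have "p ^ (2 * ?d) dvd lacunary p i"
        using lacunary_dvd [OF that, of p] dvd_trans [of "p ^ (2 * ?d)" "lacunary p (Suc k)"] by simp
      then obtain t where "lacunary p i = p ^ (2 * ?d) * t" ..
      then have "1 / ?P * of_nat (lacunary p i) = of_nat t"
        using P by simp
      then show ?thesis by (metis Ints_of_nat)
    qed
    from twist_eq_mod_Ints [of "Suc k", OF this]
    have "of_nat n * (twist p (1 / ?P) - 1 / ?P * of_nat (?S (Suc k))) \<in> \<int>"
      by (intro Ints_mult) auto
    from Ints_add [OF this int [of "2 * ?d"]]
    have "(of_int m - of_nat n * of_nat (?S (Suc k))) / ?P \<in> \<int>"
      by (simp add: m right_diff_distrib diff_divide_distrib del: sum.lessThan_Suc)
    then obtain z where "(of_int m - of_nat n * of_nat (?S (Suc k))) / ?P = of_int z"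
      by (auto elim: Ints_cases)
    then have "(of_int (m - int n * int (?S (Suc k))) :: rat) = of_int (int (p ^ (2 * ?d)) * z)"
      using P by (simp add: field_simps)
    then have "m - int n * int (?S (Suc k)) = int (p ^ (2 * ?d)) * z"
      by (simp only: of_int_eq_iff)
    then have "int (p ^ (2 * ?d)) dvd m - int n * int (?S (Suc k))"
      by simp
    \<comment> \<open>With \<open>?d\<close> at least |m| + 2n, the difference is at most (|m| +
      2n)(d + 1), which is less than (d + 1)^2, and d + 1 is at most p^d.\<close>
    moreover have "\<bar>m - int n * int (?S (Suc k))\<bar> < int (p ^ (2 * ?d))"
    proof -
      have d: "nat \<bar>m\<bar> + 2 * n \<le> ?d"
        using k lacunary_ge [OF p, of k] by simp
      have "n * ?S (Suc k) \<le> n * (2 * ?d)"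
        using lacunary_sum_le [OF p] by (intro mult_left_mono) auto
      then have "nat \<bar>m\<bar> + n * ?S (Suc k) \<le> nat \<bar>m\<bar> + n * (2 * ?d)"
        by (rule add_left_mono)
      also have "\<dots> \<le> nat \<bar>m\<bar> * Suc ?d + 2 * n * Suc ?d"
        by (simp add: algebra_simps)
      also have "\<dots> = (nat \<bar>m\<bar> + 2 * n) * Suc ?d"
        by (simp add: algebra_simps)
      also have "\<dots> \<le> ?d * Suc ?d"
        using d by (intro mult_right_mono) auto
      also have "\<dots> < Suc ?d * Suc ?d"
        by simp
      also have "\<dots> \<le> p ^ ?d * p ^ ?d"
      proof (intro mult_mono)
        have "Suc ?d \<le> 2 ^ ?d" by (simp add: Suc_leI)
        also have "\<dots> \<le> p ^ ?d" using p by (intro power_mono) auto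
        finally show "Suc ?d \<le> p ^ ?d" .
        then show "Suc ?d \<le> p ^ ?d" .
      qed auto
      finally have "nat \<bar>m\<bar> + n * ?S (Suc k) < p ^ (2 * ?d)"
        by (simp add: mult_2 power_add)
      then have "int (nat \<bar>m\<bar>) + int (n * ?S (Suc k)) < int (p ^ (2 * ?d))"
        by linarith
      moreover have "0 \<le> int n * int (?S (Suc k))"
        by (intro mult_nonneg_nonneg of_nat_0_le_iff)
      ultimately show ?thesis
        by (simp only: of_nat_mult)
    qed
    ultimately have "m - int n * int (?S (Suc k)) = 0"
      using zdvd_not_zless [of "\<bar>m - int n * int (?S (Suc k))\<bar>" "int (p ^ (2 * ?d))"]
      by (metis dvd_abs_iff zero_less_abs_iff)
    then show ?thesis by simp
  qed
  let ?k = "nat \<bar>m\<bar> + 2 * n"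
  have "int n * int (?S (Suc ?k)) = int n * int (?S (Suc (Suc ?k)))"
    using eq [of ?k] eq [of "Suc ?k"] by simp
  then have "?S (Suc ?k) = ?S (Suc (Suc ?k))"
    using n by (simp del: sum.lessThan_Suc of_nat_sum)
  then have "lacunary p (Suc ?k) = 0"
    by (simp del: lacunary.simps)
  then show False
    using lacunary_pos [OF p, of "Suc ?k"] by (simp del: lacunary.simps)
qed

subsection \<open>The \<open>p\<close>-rank\<close>

context comm_group
begin

text \<open>A nontrivial \<open>x\<close> has order \<open>p\<close>, so the exponent of its
  nontrivial power in the subgroup is prime to \<open>p\<close>, and Bezout gives \<open>x\<close>
  itself.\<close>

lemma p_torsion_in_generate:
  assumes S: "maximal_independent G {x \<in> carrier G. \<exists>k. ord x = p ^ k} S"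
    and p: "prime p" and x: "x \<in> carrier G" "x [^] p = \<one>"
  shows "x \<in> generate G S"
proof (cases "x = \<one>")
  case True
  then show ?thesis by (simp add: generate.one)
next
  case False
  have "S \<subseteq> carrier G"
    using S by (auto simp: maximal_independent_def)
  have "ord x dvd p"
    using x pow_eq_id by blast
  then have ord: "ord x = p"
    using p False x ord_eq_1 by (metis prime_nat_iff)
  then have "\<exists>k. ord x = p ^ k"
    by (metis power_one_right)
  then obtain n :: int where n: "x [^] n \<noteq> \<one>" "x [^] n \<in> generate G S"
    using maximal_independent_int_pow [OF S] x False by blast
  then have "\<not> int p dvd n"
    using x ord int_pow_eq_id by simp
  then have "coprime n (int p)"
    using prime_imp_coprime [of "int p" n] p by (simp add: coprime_commute)
  then obtain u v where uv: "u * n + v * int p = 1"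
    using bezout_int [of n "int p"] by auto
  have "x = x [^] (n * u + int p * v)"
    using uv x by (simp add: mult.commute)
  also have "\<dots> = (x [^] n) [^] u \<otimes> (x [^] int p) [^] v"
    using x by (simp add: int_pow_mult int_pow_pow)
  also have "\<dots> = (x [^] n) [^] u"
    using x by (simp add: int_pow_int)
  also have "\<dots> \<in> generate G S"
    by (intro subgroup_int_pow_closed generate_is_subgroup n \<open>S \<subseteq> carrier G\<close>)
  finally show ?thesis .
qed

lemma ex_nat_pow_in_generate:
  assumes S: "maximal_independent G {x \<in> carrier G. ord x = 0} S" and x: "x \<in> carrier G"
  shows "\<exists>n::nat. n > 0 \<and> x [^] n \<in> generate G S"
proof (cases "ord x = 0")
  case False
  then show ?thesis
    using x generate.one pow_ord_eq_1 by (metis neq0_conv)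
next
  case True
  have SG: "S \<subseteq> carrier G"
    using S by (auto simp: maximal_independent_def)
  have "x \<noteq> \<one>"
    using True by auto
  then obtain n :: int where n: "x [^] n \<noteq> \<one>" "x [^] n \<in> generate G S"
    using maximal_independent_int_pow [OF S] x True by blast
  then have "n \<noteq> 0" by auto
  have "x [^] (n * sgn n) \<in> generate G S"
    using subgroup_int_pow_closed [OF generate_is_subgroup [OF SG] n(2), of "sgn n"] x
    by (simp add: int_pow_pow)
  moreover have "n * sgn n = int (nat \<bar>n\<bar>)"
    by (simp add: sgn_if)
  ultimately have "x [^] nat \<bar>n\<bar> \<in> generate G S"
    by (simp only: int_pow_int)
  then show ?thesis
    using \<open>n \<noteq> 0\<close> by (intro exI [of _ "nat \<bar>n\<bar>"]) auto
qed

lemma additive_nat_pow: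
  assumes "additive G g" "y \<in> carrier G"
  shows "g (y [^] (n::nat)) = of_nat n * g y"
proof (induction n)
  case 0
  have "g (\<one> \<otimes> \<one>) = g \<one> + g \<one>"
    using assms(1) unfolding additive_def by blast
  then show ?case by simp
next
  case (Suc n)
  have "g (y [^] Suc n) = g (y [^] n) + g y"
    using assms unfolding additive_def by simp
  then show ?case using Suc by (simp add: algebra_simps)
qed

text \<open>The form in which the vanishing of Hom into the integers enters; the floor turns
  \<open>g\<close> into an element of \<open>hom_group\<close>.\<close>

lemma additive_integral_eq_0:
  assumes triv: "trivial_group (hom_group G integer_group)"
    and g: "additive G g" "\<And>a. a \<in> carrier G \<Longrightarrow> g a \<in> \<int>" and a: "a \<in> carrier G"
  shows "g a = 0"
proof -
  let ?f = "\<lambda>a\<in>carrier G. \<lfloor>g a\<rfloor>"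
  have "\<lfloor>g (a \<otimes> b)\<rfloor> = \<lfloor>g a\<rfloor> + \<lfloor>g b\<rfloor>" if "a \<in> carrier G" "b \<in> carrier G" for a b
    using g that by (auto simp: additive_def elim!: Ints_cases [OF g(2)])
  then have "?f \<in> carrier (hom_group G integer_group)"
    by (auto simp: hom_group_def hom_def)
  then have "?f = \<one>\<^bsub>hom_group G integer_group\<^esub>"
    using triv unfolding trivial_group_def by blast
  also have "\<dots> = (\<lambda>x\<in>carrier G. 0)"
    by (simp add: hom_group_def)
  finally have "?f = (\<lambda>x\<in>carrier G. 0)" .
  then have "?f a = (\<lambda>x\<in>carrier G. 0) a" by (rule fun_cong)
  then have "\<lfloor>g a\<rfloor> = 0" using a by simp
  then show ?thesis using g(2) [OF a] by (metis of_int_floor of_int_0)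
qed

section \<open>Upper and lower bounds for \<open>nu p\<close>\<close>

text \<open>A homomorphism on the relations is determined by its graph, a subset of a set no larger
  than \<open>carrier G\<close>.\<close>

lemma card_of_Ext_le:
  assumes inf: "infinite (carrier G)"
  shows "|carrier (Ext G integer_group)| \<le>o |Pow (carrier G)|"
proof -
  let ?R = "carrier (relation_group G)"
  have "|carrier (Ext G integer_group)| \<le>o |carrier Hom_relations|"
    unfolding Ext_eq carrier_FactGroup by (rule card_of_image)
  also have "|carrier Hom_relations| \<le>o |Pow (?R \<times> (UNIV :: int set))|"
  proof (rule card_of_ordLeqI [where f = "\<lambda>f. (\<lambda>c. (c, f c)) ` ?R"])
    show "inj_on (\<lambda>f. (\<lambda>c. (c, f c)) ` ?R) (carrier Hom_relations)"
    proof (rule inj_onI)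
      fix f g assume fg: "f \<in> carrier Hom_relations" "g \<in> carrier Hom_relations"
        and eq: "(\<lambda>c. (c, f c)) ` ?R = (\<lambda>c. (c, g c)) ` ?R"
      show "f = g"
      proof (rule extensionalityI [of _ ?R])
        fix c assume "c \<in> ?R"
        then have "(c, f c) \<in> (\<lambda>c. (c, g c)) ` ?R" using eq by blast
        then show "f c = g c" by auto
      qed (use fg in \<open>auto simp: hom_group_def\<close>)
    qed
  qed auto
  also have "|Pow (?R \<times> (UNIV :: int set))| \<le>o |Pow (carrier G)|"
  proof (intro card_of_Pow_mono card_of_Times_ordLeq_infinite inf)
    have "?R \<subseteq> carrier (free_Abelian_group (carrier G))"
      by (auto simp: carrier_relation_group)
    then have "|?R| \<le>o |carrier (free_Abelian_group (carrier G))|"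
      by (rule card_of_mono1)
    also have "|carrier (free_Abelian_group (carrier G))| =o |carrier G|"
      using eqpoll_free_Abelian_group_infinite [OF inf] by (simp add: eqpoll_iff_card_of_ordIso)
    finally show "|?R| \<le>o |carrier G|" .
    show "|UNIV :: int set| \<le>o |carrier G|"
      using inf infinite_iff_card_of_countable [of "UNIV :: int set" "carrier G"] by simp
  qed
  finally show ?thesis .
qed

lemma p_rank_set:
  obtains S where "nu p G = |S|"
    "maximal_independent (Ext G integer_group)
      {x \<in> carrier (Ext G integer_group). \<exists>k. group.ord (Ext G integer_group) x = p ^ k} S"
  using someI_ex [OF comm_group.ex_maximal_independent [OF comm_group_Ext]]
  unfolding nu_def p_rank_def by blast

lemma torsion_free_rank_set:
  obtains S where "nu_0 G = |S|"
    "maximal_independent (Ext G integer_group)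
      {x \<in> carrier (Ext G integer_group). group.ord (Ext G integer_group) x = 0} S"
  using someI_ex [OF comm_group.ex_maximal_independent [OF comm_group_Ext]]
  unfolding nu_0_def torsion_free_rank_def by blast

lemma nu_le:
  assumes "infinite (carrier G)"
  shows "nu p G \<le>o |Pow (carrier G)|"
proof -
  obtain S where S: "nu p G = |S|" "maximal_independent (Ext G integer_group)
      {x \<in> carrier (Ext G integer_group). \<exists>k. group.ord (Ext G integer_group) x = p ^ k} S"
    by (rule p_rank_set)
  then have "S \<subseteq> carrier (Ext G integer_group)"
    by (auto simp: maximal_independent_def)
  then have "|S| \<le>o |carrier (Ext G integer_group)|"
    by (rule card_of_mono1)
  then show ?thesis
    unfolding S(1) by (rule ordLeq_transitive [OF _ card_of_Ext_le [OF assms]])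
qed

text \<open>Division by \<open>p\<close> sends \<open>Hom(G, \<int>/p)\<close> to the \<open>p\<close>-torsion of \<open>Ext G \<int>\<close>; this is injective as there are
  no nonzero homomorphisms \<open>G \<rightarrow> \<int>\<close>.\<close>

lemma nu_ge:
  assumes X: "maximal_independent_mod G (int p) K X" and p: "prime p"
    and triv: "trivial_group (hom_group G integer_group)"
    and inf: "infinite (carrier G)" and card: "|carrier G| \<le>o |X|"
  shows "|Pow (carrier G)| \<le>o nu p G"
proof -
  interpret X: maximal_independent_mod G "int p" K X by (rule X)
  let ?E = "Ext G integer_group"
  interpret E: comm_group ?E by (rule comm_group_Ext)
  obtain S where nu: "nu p G = |S|" and S: "maximal_independent ?E
      {x \<in> carrier ?E. \<exists>k. group.ord ?E x = p ^ k} S"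
    by (rule p_rank_set)
  have p0: "p > 0" using p prime_gt_0_nat by blast
  \<comment> \<open>Prescribing the indicator function of each subset \<open>Y\<close> on
    \<open>X\<close> gives one homomorphism modulo \<open>p\<close> per subset.\<close>
  have "\<exists>h. (\<forall>a\<in>carrier G. \<forall>b\<in>carrier G. int p dvd h (a \<otimes> b) - (h a + h b)) \<and>
      (\<forall>x\<in>X. int p dvd h x - of_bool (x \<in> Y))" for Y
    using X.ex_modular_functional [of "\<lambda>x. of_bool (x \<in> Y)"] p by simp
  then obtain h :: "'a set \<Rightarrow> 'a \<Rightarrow> int" where
    h_add: "\<And>Y a b. a \<in> carrier G \<Longrightarrow> b \<in> carrier G \<Longrightarrow> int p dvd h Y (a \<otimes> b) - (h Y a + h Y b)"
    and h_X: "\<And>Y x. x \<in> X \<Longrightarrow> int p dvd h Y x - of_bool (x \<in> Y)"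
    by metis
  define u :: "'a set \<Rightarrow> 'a \<Rightarrow> rat" where "u Y a = of_int (h Y a) / of_nat p" for Y a
  have u: "additive_mod_Ints G (u Y)" for Y
    unfolding additive_mod_Ints_def
  proof (intro ballI)
    fix a b assume "a \<in> carrier G" "b \<in> carrier G"
    then obtain t where "h Y (a \<otimes> b) - (h Y a + h Y b) = int p * t"
      using h_add by blast
    then have "(of_int (h Y (a \<otimes> b) - (h Y a + h Y b)) :: rat) = of_int (int p * t)"
      by (simp only:)
    then have "u Y (a \<otimes> b) - (u Y a + u Y b) = of_int t"
      using p0 by (simp add: u_def field_simps)
    then show "u Y (a \<otimes> b) - (u Y a + u Y b) \<in> \<int>"
      by (metis Ints_of_int)
  qed
  have in_gen: "ext_class (u Y) \<in> generate ?E S" for Y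
  proof (rule E.p_torsion_in_generate [OF S p])
    show "ext_class (u Y) \<in> carrier ?E"
      using u by (rule ext_class_closed)
    show "ext_class (u Y) [^]\<^bsub>?E\<^esub> p = \<one>\<^bsub>?E\<^esub>"
      using u by (rule ext_class_pow_eq_one) (use p0 in \<open>simp add: u_def\<close>)
  qed
  have inj: "inj_on (\<lambda>Y. ext_class (u Y)) (Pow X)"
  proof (rule inj_onI)
    fix Y Y' assume Y: "Y \<in> Pow X" "Y' \<in> Pow X" and eq: "ext_class (u Y) = ext_class (u Y')"
    then have "ext_class (u Y) [^]\<^bsub>?E\<^esub> (1::nat) = ext_class (u Y') [^]\<^bsub>?E\<^esub> (1::nat)"
      by simp
    from ext_class_pow_eq_imp_additive [OF u u this] obtain w :: "'a \<Rightarrow> int"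
      where w: "additive G (\<lambda>a. u Y a - u Y' a - of_int (w a))" by auto
    \<comment> \<open>The factor \<open>p\<close> clears the denominators of \<open>u\<close>, so
      \<open>g\<close> is integral and must vanish. Then \<open>h Y\<close> and \<open>h Y'\<close>
      are congruent modulo \<open>p\<close> on the carrier.\<close>
    define g where "g a = of_nat p * (u Y a - u Y' a - of_int (w a))" for a
    have g: "g a = of_int (h Y a - h Y' a - int p * w a)" for a
      using p0 by (simp add: g_def u_def field_simps)
    have "additive G g"
      unfolding additive_def
    proof (intro ballI)
      fix a b assume "a \<in> carrier G" "b \<in> carrier G"
      then have "u Y (a \<otimes> b) - u Y' (a \<otimes> b) - of_int (w (a \<otimes> b)) =
          (u Y a - u Y' a - of_int (w a)) + (u Y b - u Y' b - of_int (w b))"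
        using w unfolding additive_def by blast
      then show "g (a \<otimes> b) = g a + g b"
        unfolding g_def by (simp only: distrib_left)
    qed
    then have g0: "g a = 0" if "a \<in> carrier G" for a
      by (rule additive_integral_eq_0 [OF triv _ _ that]) (metis g Ints_of_int)
    have "x \<in> Y \<longleftrightarrow> x \<in> Y'" if x: "x \<in> X" for x
    proof -
      have "x \<in> carrier G" using x X.X_subset by auto
      then have "(of_int (h Y x - h Y' x - int p * w x) :: rat) = of_int 0"
        using g0 g by simp
      then have eq: "h Y x - h Y' x = int p * w x"
        by (simp only: of_int_eq_iff)
      have "int p dvd (h Y x - of_bool (x \<in> Y)) - (h Y' x - of_bool (x \<in> Y'))"
        by (rule dvd_diff [OF h_X [OF x] h_X [OF x]])
      also have "(h Y x - of_bool (x \<in> Y)) - (h Y' x - of_bool (x \<in> Y')) =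
          int p * w x - (of_bool (x \<in> Y) - of_bool (x \<in> Y'))"
        using eq by simp
      finally have "int p dvd of_bool (x \<in> Y) - of_bool (x \<in> Y')"
        by (simp add: dvd_diff_right_iff dvd_diff_left_iff)
      then show ?thesis
        using p by (cases "x \<in> Y"; cases "x \<in> Y'") (auto simp: prime_nat_iff)
    qed
    then show "Y = Y'" using Y by blast
  qed
  have "|Pow (carrier G)| \<le>o |Pow X|"
    using card by (rule card_of_Pow_mono)
  also have "|Pow X| \<le>o |generate ?E S|"
    using inj in_gen by (intro card_of_ordLeqI [where f = "\<lambda>Y. ext_class (u Y)"]) auto
  finally have le: "|Pow (carrier G)| \<le>o |generate ?E S|" .
  have "S \<subseteq> carrier ?E"
    using S by (auto simp: maximal_independent_def)
  from card_of_le_Pow_generate [OF comm_group_Ext this inf le] show ?thesis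
    unfolding nu .
qed

text \<open>The quotient by \<open>B\<close> is \<open>p\<close>-divisible, hence divisible by every
  power of \<open>p\<close>; the remainders accumulate inside \<open>B\<close>.\<close>

lemma ex_power_mult:
  assumes B: "subgroup B G" and div: "\<And>a. a \<in> carrier G \<Longrightarrow> \<exists>b\<in>B. \<exists>y\<in>carrier G. a = y [^] (p::nat) \<otimes> b"
    and a: "a \<in> carrier G"
  shows "\<exists>b\<in>B. \<exists>y\<in>carrier G. a = y [^] (p ^ j) \<otimes> b"
proof (induction j)
  case 0
  then show ?case
    using a subgroup.one_closed [OF B] by (intro bexI [of _ \<one>] bexI [of _ a]) auto
next
  case (Suc j)
  then obtain b y where b: "b \<in> B" "y \<in> carrier G" "a = y [^] (p ^ j) \<otimes> b" by auto
  from div [OF b(2)] obtain b' z where z: "b' \<in> B" "z \<in> carrier G" "y = z [^] p \<otimes> b'" by auto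
  have G: "b \<in> carrier G" "b' \<in> carrier G"
    using b z subgroup.subset [OF B] by auto
  have "a = (z [^] p) [^] (p ^ j) \<otimes> (b' [^] (p ^ j) \<otimes> b)"
    using G b z by (simp add: pow_mult_distrib m_comm m_assoc)
  also have "(z [^] p) [^] (p ^ j) = z [^] (p ^ Suc j)"
    using z(2) by (simp add: nat_pow_pow)
  finally have "a = z [^] (p ^ Suc j) \<otimes> (b' [^] (p ^ j) \<otimes> b)" .
  moreover have "b' [^] (p ^ j) \<otimes> b \<in> B"
    using subgroup_int_pow_closed [OF B z(1), of "int (p ^ j)"]
    by (intro subgroup.m_closed [OF B _ b(1)]) (simp only: int_pow_int)
  ultimately show ?case
    using z(2) by blast
qed

end

subsection \<open>The torsion-free rank\<close>

text \<open>Bounds the codes used in \<open>nu_0_ge\<close>: an exponent, a class, and the graph of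
  an integral function on \<open>B\<close>.\<close>

lemma card_of_times_graphs_le:
  assumes Z: "|C| \<le>o |Z|" and B: "infinite B" "|Pow B| \<le>o |Z|"
  shows "|((UNIV :: nat set) \<times> C) \<times> Pow (B \<times> (UNIV :: int set))| \<le>o |Z|"
proof -
  have inf: "infinite Z"
    using B card_of_ordLeq_infinite [OF B(2)] by (simp add: finite_Pow_iff)
  have "|UNIV :: nat set| \<le>o |Z|"
    using inf infinite_iff_card_of_nat by blast
  moreover have "|UNIV :: int set| \<le>o |B|"
    using B(1) infinite_iff_card_of_countable [of "UNIV :: int set" B] by simp
  then have "|B \<times> (UNIV :: int set)| \<le>o |B|"
    using B(1) by (intro card_of_Times_ordLeq_infinite) auto
  then have "|Pow (B \<times> (UNIV :: int set))| \<le>o |Z|"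
    using card_of_Pow_mono B(2) ordLeq_transitive by blast
  ultimately show ?thesis
    using inf Z by (intro card_of_Times_ordLeq_infinite)
qed

context comm_group
begin

text \<open>The classes counted here are those of the twisted rational functionals. A relation among them
  that is invisible on \<open>B\<close> comes from a rational functional \<open>g\<close> vanishing on \<open>B\<close>, whose values on the
  \<open>p\<close>-divisible group \<open>G/B\<close> would exhibit the limit of the lacunary series as a rational number.\<close>

lemma nu_0_ge:
  assumes tf: "torsion_free G" and p: "2 \<le> (p :: nat)" and B: "subgroup B G" "infinite B"
    and less: "|B| <o |carrier G|" and Pow_B: "|Pow B| \<le>o |carrier G|"
    and div: "\<And>a. a \<in> carrier G \<Longrightarrow> \<exists>b\<in>B. \<exists>y\<in>carrier G. a = y [^] p \<otimes> b"
  shows "|Pow (carrier G)| \<le>o nu_0 G"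
proof (rule ccontr)
  assume not_le: "\<not> ?thesis"
  have BG: "B \<subseteq> carrier G"
    using subgroup.subset [OF B(1)] .
  then have inf: "infinite (carrier G)"
    using B(2) finite_subset by blast
  obtain X where X: "independent_mod G 0 B X" "\<And>Y. independent_mod G 0 B Y \<Longrightarrow> X \<subseteq> Y \<Longrightarrow> Y = X"
    using ex_maximal_independent_mod by metis
  interpret X: maximal_independent_mod G 0 B X
    using B(1) X subgroup.one_closed [OF B(1)]
    by (intro maximal_independent_mod.intro maximal_independent_mod_axioms.intro comm_group_axioms) auto
  let ?E = "Ext G integer_group"
  interpret E: comm_group ?E by (rule comm_group_Ext)
  obtain S where nu: "nu_0 G = |S|" and S: "maximal_independent ?E {x \<in> carrier ?E. group.ord ?E x = 0} S"
    by (rule torsion_free_rank_set)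
  \<comment> \<open>Otherwise \<open>X\<close> and \<open>B\<close> together would be smaller than
    \<open>G\<close>, which \<open>card_of_carrier_le\<close> rules out.\<close>
  have X_card: "|carrier G| \<le>o |X|"
  proof (rule ccontr)
    assume "\<not> ?thesis"
    then have "|X| <o |carrier G|" by simp
    then have "|X \<union> B| <o |carrier G|"
      using less inf by (intro card_of_Un_ordLess_infinite)
    moreover have "|carrier G| \<le>o |X \<union> B|"
      using B(2) by (intro X.card_of_carrier_le tf card_of_mono1) auto
    ultimately show False
      using not_ordLess_ordLeq by blast
  qed
  have "\<exists>h. additive G h \<and> (\<forall>x\<in>X. h x = of_bool (x \<in> Y)) \<and> (\<forall>k\<in>B. h k = 0)" for Y
    using X.ex_rational_functional [of "\<lambda>x. of_bool (x \<in> Y)"] by simp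
  then obtain h :: "'a set \<Rightarrow> 'a \<Rightarrow> rat" where
    h_add: "\<And>Y. additive G (h Y)" and h_X: "\<And>Y x. x \<in> X \<Longrightarrow> h Y x = of_bool (x \<in> Y)"
    and h_B: "\<And>Y k. k \<in> B \<Longrightarrow> h Y k = 0"
    by metis
  define u where "u Y a = twist p (h Y a)" for Y a
  have u: "additive_mod_Ints G (u Y)" for Y
    using h_add [of Y] twist_add_mod_Ints by (simp add: additive_mod_Ints_def additive_def u_def)
  have "\<exists>n::nat. n > 0 \<and> ext_class (u Y) [^]\<^bsub>?E\<^esub> n \<in> generate ?E S" for Y
    by (rule E.ex_nat_pow_in_generate [OF S ext_class_closed [OF u]])
  then obtain n :: "'a set \<Rightarrow> nat" where n_pos: "\<And>Y. n Y > 0"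
    and n_gen: "\<And>Y. ext_class (u Y) [^]\<^bsub>?E\<^esub> n Y \<in> generate ?E S"
    by metis
  define t where "t Y = (n Y, ext_class (u Y) [^]\<^bsub>?E\<^esub> n Y)" for Y
  \<comment> \<open>All \<open>Y\<close> with the same code share this representative, so their
    integral corrections \<open>w\<close> refer to a common origin and can be compared.\<close>
  define base where "base Y = inv_into (Pow X) t (t Y)" for Y
  have base: "t (base Y) = t Y" if "Y \<subseteq> X" for Y
    unfolding base_def using that by (intro f_inv_into_f) auto
  have "\<exists>w :: 'a \<Rightarrow> int. additive G (\<lambda>a. of_nat (n Y) * (u Y a - u (base Y) a) - of_int (w a))" if "Y \<subseteq> X" for Y
  proof -
    have "ext_class (u Y) [^]\<^bsub>?E\<^esub> n Y = ext_class (u (base Y)) [^]\<^bsub>?E\<^esub> n Y"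
      using base [OF that] unfolding t_def prod.inject by metis
    from ext_class_pow_eq_imp_additive [OF u u this] show ?thesis by metis
  qed
  then obtain w :: "'a set \<Rightarrow> 'a \<Rightarrow> int" where
    w: "\<And>Y. Y \<subseteq> X \<Longrightarrow> additive G (\<lambda>a. of_nat (n Y) * (u Y a - u (base Y) a) - of_int (w Y a))"
    by metis
  have subset: "Y \<subseteq> Y'" if Y: "Y \<subseteq> X" "Y' \<subseteq> X" and t_eq: "t Y = t Y'" and w_eq: "\<And>b. b \<in> B \<Longrightarrow> w Y b = w Y' b" for Y Y'
  proof (rule ccontr)
    assume "\<not> ?thesis"
    then obtain x where x: "x \<in> Y" "x \<notin> Y'" by auto
    have xG: "x \<in> carrier G"
      using x Y X.X_subset by auto
    have n_eq: "n Y' = n Y" using t_eq by (simp add: t_def)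
    have base_eq: "base Y' = base Y" using t_eq by (simp add: base_def)
    \<comment> \<open>The base terms cancel in this difference; on \<open>B\<close> the functionals
      vanish and the corrections agree, so \<open>g\<close> vanishes there.\<close>
    define g where "g a = (of_nat (n Y) * (u Y a - u (base Y) a) - of_int (w Y a)) -
      (of_nat (n Y') * (u Y' a - u (base Y') a) - of_int (w Y' a))" for a
    have g_eq: "g a = of_nat (n Y) * (u Y a - u Y' a) - of_int (w Y a - w Y' a)" for a
      unfolding g_def n_eq base_eq by (simp add: algebra_simps)
    have "additive G g"
      unfolding g_def by (rule additive_diff [OF w [OF Y(1)] w [OF Y(2)]])
    have g_B: "g b = 0" if "b \<in> B" for b
      using that by (simp add: g_eq u_def h_B w_eq)
    \<comment> \<open>This is the hypothesis of \<open>twist_irrational\<close> with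
      \<open>M = g x\<close>. Modulo \<open>B\<close>, \<open>x\<close> is the
      \<open>p ^ j\<close>-th power of some \<open>y\<close>, at which \<open>h Y\<close> equals 1 /
      p^j and \<open>h Y'\<close> vanishes.\<close>
    have "g x / of_nat p ^ j - of_nat (n Y) * twist p (1 / of_nat p ^ j) \<in> \<int>" for j
    proof -
      obtain b y where b: "b \<in> B" and y: "y \<in> carrier G" and eq: "x = y [^] (p ^ j) \<otimes> b"
        using ex_power_mult [OF B(1) div xG] by blast
      have f_x: "f x = of_nat p ^ j * f y" if "additive G f" "f b = 0" for f
      proof -
        have "f x = f (y [^] (p ^ j)) + f b"
          using that(1) y b BG unfolding additive_def eq by blast
        then show ?thesis
          using additive_nat_pow [OF that(1) y] that(2) by simp
      qed
      have p0: "of_nat p ^ j \<noteq> (0 :: rat)"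
        using p by simp
      have gy: "g x / of_nat p ^ j = g y"
        using f_x [OF \<open>additive G g\<close> g_B [OF b]] p0 by simp
      have "x \<in> X" using x Y by auto
      then have "h Y y = 1 / of_nat p ^ j" "h Y' y = 0"
        using f_x [OF h_add h_B [OF b], of Y] f_x [OF h_add h_B [OF b], of Y'] h_X x p0
        by (auto simp: field_simps)
      then have "g y = of_nat (n Y) * twist p (1 / of_nat p ^ j) - of_int (w Y y - w Y' y)"
        by (simp add: g_eq u_def)
      then have "g x / of_nat p ^ j - of_nat (n Y) * twist p (1 / of_nat p ^ j) = of_int (w Y' y - w Y y)"
        by (simp add: gy)
      then show ?thesis by (metis Ints_of_int)
    qed
    then show False
      using twist_irrational [OF p n_pos [of Y]] by blast
  qed
  let ?D = "((UNIV :: nat set) \<times> generate ?E S) \<times> Pow (B \<times> (UNIV :: int set))"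
  have "|Pow X| \<le>o |?D|"
  proof (rule card_of_ordLeqI [where f = "\<lambda>Y. (t Y, (\<lambda>b. (b, w Y b)) ` B)"])
    show "inj_on (\<lambda>Y. (t Y, (\<lambda>b. (b, w Y b)) ` B)) (Pow X)"
    proof (rule inj_onI)
      fix Y Y' assume Y: "Y \<in> Pow X" "Y' \<in> Pow X"
        and eq: "(t Y, (\<lambda>b. (b, w Y b)) ` B) = (t Y', (\<lambda>b. (b, w Y' b)) ` B)"
      have t: "t Y = t Y'" and graph: "(\<lambda>b. (b, w Y b)) ` B = (\<lambda>b. (b, w Y' b)) ` B"
        using eq by auto
      have w_eq: "w Y b = w Y' b" if "b \<in> B" for b
      proof -
        have "(b, w Y b) \<in> (\<lambda>b. (b, w Y' b)) ` B"
          using that graph by blast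
        then show ?thesis by auto
      qed
      show "Y = Y'"
        using subset [of Y Y'] subset [of Y' Y] Y t w_eq by auto
    qed
  qed (auto simp: t_def n_gen)
  then have Pow_D: "|Pow (carrier G)| \<le>o |?D|"
    using card_of_Pow_mono [OF X_card] ordLeq_transitive by blast
  have SE: "S \<subseteq> carrier ?E"
    using S by (auto simp: maximal_independent_def)
  show False
  \<comment> \<open>A generated subgroup of size at least |G| absorbs the other two factors of the
    code; a smaller one leaves at most |G| codes, fewer than the subsets of
    \<open>X\<close>.\<close>
  proof (cases "|carrier G| \<le>o |generate ?E S|")
    case True
    have "|?D| \<le>o |generate ?E S|"
      by (intro card_of_times_graphs_le B(2) ordLeq_transitive [OF Pow_B True]) simp
    with Pow_D have "|Pow (carrier G)| \<le>o |generate ?E S|"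
      by (rule ordLeq_transitive)
    from card_of_le_Pow_generate [OF comm_group_Ext SE inf this] show False
      using not_le nu by simp
  next
    case False
    then have "|generate ?E S| \<le>o |carrier G|"
      by (meson card_of_Well_order ordLeq_total)
    then have "|?D| \<le>o |carrier G|"
      by (intro card_of_times_graphs_le B(2) Pow_B)
    with Pow_D have "|Pow (carrier G)| \<le>o |carrier G|"
      by (rule ordLeq_transitive)
    then show False
      using card_of_Pow [of "carrier G"] not_ordLess_ordLeq by blast
  qed
qed

end

section \<open>The two cases for the dimension of A/pA\<close>

theorem theorem1p3:
  fixes A :: "('a, 'm) monoid_scheme"
  assumes "GCH TYPE('a)"
    and "comm_group A"
    and "torsion_free A"
    and "uncountable (carrier A)"
    and "trivial_group (hom_group A integer_group)"
    and "nu_0 A <o ctwo ^c |carrier A|"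
  shows "\<forall>p :: nat. prime p \<longrightarrow> nu p A =o ctwo ^c |carrier A|"
proof (intro allI impI)
  fix p :: nat assume p: "prime p"
  interpret A: comm_group A by fact
  let ?\<kappa> = "|carrier A|"
  have inf: "infinite (carrier A)"
    using assms(4) countable_finite by blast
  let ?K = "(\<lambda>y. y [^]\<^bsub>A\<^esub> int p) ` carrier A"
  have "(\<lambda>y. y [^]\<^bsub>A\<^esub> int p) \<in> hom A A"
    by (auto simp: hom_def A.int_pow_distrib)
  then interpret pow: group_hom A A "\<lambda>y. y [^]\<^bsub>A\<^esub> int p"
    by (simp add: group_hom_def group_hom_axioms_def A.is_group)
  \<comment> \<open>\<open>X\<close> is a basis of \<open>A\<close> modulo \<open>p\<close>-th
    powers over the field with \<open>p\<close> elements.\<close>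
  obtain X where X: "independent_mod A (int p) ?K X"
    "\<And>Y. independent_mod A (int p) ?K Y \<Longrightarrow> X \<subseteq> Y \<Longrightarrow> Y = X"
    using ex_maximal_independent_mod by metis
  interpret X: maximal_independent_mod A "int p" ?K X
    using p X pow.img_is_subgroup
    by (intro maximal_independent_mod.intro maximal_independent_mod_axioms.intro A.comm_group_axioms) auto
  have "|Pow (carrier A)| \<le>o nu p A"
  proof (cases "?\<kappa> \<le>o |X|")
    case True
    show ?thesis
      by (rule A.nu_ge [OF X.maximal_independent_mod_axioms p assms(5) inf True])
  next
    case False
    \<comment> \<open>Adjoining a countably infinite set makes \<open>B\<close> infinite, as GCH
      requires; uncountability of \<open>A\<close> keeps \<open>B\<close> smaller than
      \<open>A\<close>.\<close>
    obtain Z where Z: "Z \<subseteq> carrier A" "countable Z" "infinite Z"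
      using infinite_countable_subset' [OF inf] by blast
    define B where "B = generate A (X \<union> Z)"
    have XZ: "X \<union> Z \<subseteq> carrier A"
      using X.X_subset Z(1) by auto
    have B: "subgroup B A"
      unfolding B_def by (rule A.generate_is_subgroup [OF XZ])
    have "Z \<subseteq> B"
      by (auto simp: B_def intro: generate.incl)
    then have "infinite B"
      using Z(3) finite_subset by blast
    have "|Z| <o ?\<kappa>"
    proof (rule ccontr)
      assume "\<not> ?thesis"
      then have "?\<kappa> \<le>o |Z|" by simp
      then obtain f where "inj_on f (carrier A)" "f ` carrier A \<subseteq> Z"
        using card_of_ordLeq by metis
      then show False
        using Z(2) assms(4) countable_subset countable_image_inj_on by blast
    qed
    then have "|X \<union> Z| <o ?\<kappa>"
      using False inf by (intro card_of_Un_ordLess_infinite) simp_all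
    moreover have "|B| \<le>o |X \<union> Z|"
      unfolding B_def using XZ Z(3) by (intro A.card_of_generate_le) auto
    ultimately have B_less: "|B| <o ?\<kappa>"
      using ordLeq_ordLess_trans by blast
    \<comment> \<open>GCH makes 2^|B| the successor of |B|, which is at most |A|.\<close>
    have "|Pow B| =o ctwo ^c |B|"
      by (rule Pow_cexp_ctwo)
    also have "ctwo ^c |B| =o cardSuc |B|"
      using assms(1) \<open>infinite B\<close> by (simp add: GCH_def)
    also have "cardSuc |B| \<le>o ?\<kappa>"
      using B_less by (simp add: cardSuc_least)
    finally have Pow_B: "|Pow B| \<le>o ?\<kappa>" .
    have "|Pow (carrier A)| \<le>o nu_0 A"
    proof (rule A.nu_0_ge [OF assms(3) prime_ge_2_nat [OF p] B \<open>infinite B\<close> B_less Pow_B])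
      fix a assume "a \<in> carrier A"
      then obtain g y where "g \<in> generate A X" "y \<in> carrier A" "a = y [^]\<^bsub>A\<^esub> int p \<otimes>\<^bsub>A\<^esub> g"
        using X.ex_pow_mult_generate p by (metis prime_nat_int_transfer)
      moreover have "generate A X \<subseteq> B"
        unfolding B_def by (intro A.mono_generate) auto
      ultimately show "\<exists>b\<in>B. \<exists>y\<in>carrier A. a = y [^]\<^bsub>A\<^esub> p \<otimes>\<^bsub>A\<^esub> b"
        by (auto simp: int_pow_int)
    qed
    moreover have "nu_0 A <o |Pow (carrier A)|"
      using assms(6) Pow_cexp_ctwo ordIso_symmetric ordLess_ordIso_trans by blast
    ultimately show ?thesis
      using not_ordLess_ordLeq by blast
  qed
  with A.nu_le [OF inf, of p] have "nu p A =o |Pow (carrier A)|"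
    by (simp add: ordIso_iff_ordLeq)
  then show "nu p A =o ctwo ^c |carrier A|"
    using Pow_cexp_ctwo ordIso_transitive by blast
qed

end
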